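(* The map $\mathsf L:\mathcal Y\to\mathcal Q$, $\mathsf L(F_t):=F_{L(t)}$, is a surjective morphism of non-symmetric operads. There is a commutative diagram of surjective morphisms of non-symmetric operads $$\mathcal A\xrightarrow{\ \Lambda\ }\mathcal Y\xrightarrow{\ \mathsf L\ }\mathcal Q,\qquad \mathsf L\circ\Lambda=\mathsf D .$$
   Context: $\Bbbk$ is a commutative ring. $[n]=\{1,\dots,n\}$ (with $[0]=\emptyset$). A non-symmetric (unital) operad is a sequence of $\Bbbk$-modules $\{\mathcal P_n\}_{n\ge1}$ with linear maps $\circ_i:\mathcal P_n\otimes\mathcal P_m\to\mathcal P_{n+m-1}$ ($1\le i\le n$) and a unit $1\in\mathcal P_1$ satisfying the usual axioms: $(x\circ_iy)\circ_{j+m-1}z=(x\circ_jz)\circ_iy$ for $i<j\le n$; $(x\circ_iy)\circ_{i+j-1}z=x\circ_i(y\circ_jz)$ for $1\le i\le n$, $1\le j\le m$ ($x\in\mathcal P_n$, $y\in\mathcal P_m$); $x\circ_i1=x$; $1\circ_1x=x$. A morphism is a sequence of linear maps preserving all $\circ_i$ and the unit. Operad $\mathcal A$: $\mathcal A_n=\Bbbk S_n$ with basis $\{F_\sigma\}$, $F_\sigma\circ_iF_\tau=F_{B_i(\sigma,\tau)}$, unit $F_{(1)}$, where $B_i(\sigma,\tau):=(a_1,\dots,a_{i-1},b_1,\dots,b_m,a_{i+1},\dots,a_n)$ with $a_j=\sigma_j$ if $\sigma_j<\sigma_i$, $a_j=\sigma_j+m-1$ if $\sigma_j>\sigma_i$,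 $b_k=\tau_k+\sigma_i-1$ (for $\sigma\in S_n,\tau\in S_m$). Operad $\mathcal Q$: $\mathcal Q_n=\Bbbk Q_n$ with basis $\{F_{\mathsf S}\}$ indexed by the set $Q_n$ of subsets $\mathsf S\subseteq[n-1]$, $F_{\mathsf S}\circ_iF_{\mathsf T}=F_{B_i(\mathsf S,\mathsf T)}$, unit $F_\emptyset\in\Bbbk Q_1$, where for $\mathsf S\subseteq[n-1]$, $\mathsf T\subseteq[m-1]$, $B_i(\mathsf S,\mathsf T):=(\mathsf S\cap\{1,\dots,i-1\})\cup(\mathsf T+i-1)\cup((\mathsf S\cap\{i,\dots,n-1\})+m-1)$ and $\mathsf S+p=\{s+p:s\in\mathsf S\}$. Trees. $Y_n$ is the set of rooted planar binary trees with $n$ internal nodes ($n+1$ leaves); $|t|=n$ for $t\in Y_n$; $1_0$ is the unique element of $Y_0$. The grafting $s\vee t$ joins a new root to the roots of $s$ (left) and $t$ (right); each $t\in Y_n$, $n\ge1$, is uniquely $t=t_l\vee t_r$. $s\backslash t$: glue the root of $t$ to the rightmost branch of $s$ ($1_0\backslash t=t$, $s\backslash t=s_l\vee(s_r\backslash t)$); $s/t$: glue the root of $s$ to the leftmost branch of $t$ ($s/1_0=s$, $s/t=(s/t_l)\vee t_r$). Operad $\mathcal Y$: $\mathcal Y_n=\Bbbk Y_n$ with basis $\{F_t\}$, $F_s\circ_iF_t=F_{B_i(s,t)}$, unit $F_{\mathrm Y}$ with $\mathrm Y$ the unique element of $Y_1$, where for $s\in Y_n$, $t\in Y_m$, $j:=|s_l|+1$: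 $B_i(s,t)=s_l\vee B_{i-j}(s_r,t)$ if $j<i$; $(s_l/t_l)\vee(t_r\backslash s_r)$ if $j=i$; $B_i(s_l,t)\vee s_r$ if $j>i$. Maps. $\lambda:S_n\to Y_n$: the empty permutation goes to $1_0$; for $n\ge1$, $j:=\sigma^{-1}(n)$, $\lambda(\sigma):=\lambda(\mathrm{st}(\sigma_1,\dots,\sigma_{j-1}))\vee\lambda(\mathrm{st}(\sigma_{j+1},\dots,\sigma_n))$, where $\mathrm{st}(a)$ is the permutation with the same relative order as $a$. $\Lambda(F_\sigma):=F_{\lambda(\sigma)}$. $\mathsf D(F_\sigma):=F_{\mathrm{Des}(\sigma)}$ with $\mathrm{Des}(\sigma)=\{p\in[n-1]:\sigma_p>\sigma_{p+1}\}$. $L:Y_n\to Q_n$: number the $n-1$ leaves of $t$ other than the two outermost ones by $1,\dots,n-1$ from left to right; $L(t)$ is the set of labels of those leaves that point left (i.e. that are the left child of their parent node). *)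

theory Defs
  imports
    "HOL-Algebra.Module"
    "HOL-Combinatorics.Multiset_Permutations"
    "HOL-Library.Tree"
begin

section \<open>Non-symmetric operads\<close>

definition linear_maps ::
  "('k, 'r) ring_scheme \<Rightarrow> ('k, 'v) module \<Rightarrow> ('k, 'w) module \<Rightarrow> ('v \<Rightarrow> 'w) set" where
  "linear_maps R M N = {f \<in> carrier M \<rightarrow> carrier N.
     (\<forall>x\<in>carrier M. \<forall>y\<in>carrier M. f (x \<oplus>\<^bsub>M\<^esub> y) = f x \<oplus>\<^bsub>N\<^esub> f y) \<and>
     (\<forall>c\<in>carrier R. \<forall>x\<in>carrier M. f (c \<odot>\<^bsub>M\<^esub> x) = c \<odot>\<^bsub>N\<^esub> f x)}"

text \<open>In \<open>circ P n m i\<close> the numbers \<open>n\<close> and \<open>m\<close> are the arities of the two arguments. Only the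
  components \<open>cmp P n\<close> with \<open>n \<ge> 1\<close> and the \<open>circ P n m i\<close> with \<open>1 \<le> i \<le> n\<close> and \<open>m \<ge> 1\<close> are
  meaningful.\<close>

record ('k, 'v) operad =
  cmp :: "nat \<Rightarrow> ('k, 'v) module"
  circ :: "nat \<Rightarrow> nat \<Rightarrow> nat \<Rightarrow> 'v \<Rightarrow> 'v \<Rightarrow> 'v"
  ident :: 'v

text \<open>A linear map out of the tensor product of the components of arities \<open>n\<close> and \<open>m\<close> is given as a
  bilinear map (\<open>circ_linear_left\<close>, \<open>circ_linear_right\<close>).\<close>

locale ns_operad = cring R for R :: "('k, 'r) ring_scheme" (structure) +
  fixes P :: "('k, 'v) operad"
  assumes cmp_module: "n \<ge> 1 \<Longrightarrow> Module.module R (cmp P n)"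
    and circ_linear_left:
      "\<lbrakk>1 \<le> i; i \<le> n; m \<ge> 1; y \<in> carrier (cmp P m)\<rbrakk> \<Longrightarrow>
        (\<lambda>x. circ P n m i x y) \<in> linear_maps R (cmp P n) (cmp P (n + m - 1))"
    and circ_linear_right:
      "\<lbrakk>1 \<le> i; i \<le> n; m \<ge> 1; x \<in> carrier (cmp P n)\<rbrakk> \<Longrightarrow>
        circ P n m i x \<in> linear_maps R (cmp P m) (cmp P (n + m - 1))"
    and ident_closed: "ident P \<in> carrier (cmp P 1)"
    and circ_parallel:
      "\<lbrakk>1 \<le> i; i < j; j \<le> n; m \<ge> 1; l \<ge> 1;
        x \<in> carrier (cmp P n); y \<in> carrier (cmp P m); z \<in> carrier (cmp P l)\<rbrakk> \<Longrightarrow>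
        circ P (n + m - 1) l (j + m - 1) (circ P n m i x y) z =
        circ P (n + l - 1) m i (circ P n l j x z) y"
    and circ_sequential:
      "\<lbrakk>1 \<le> i; i \<le> n; 1 \<le> j; j \<le> m; l \<ge> 1;
        x \<in> carrier (cmp P n); y \<in> carrier (cmp P m); z \<in> carrier (cmp P l)\<rbrakk> \<Longrightarrow>
        circ P (n + m - 1) l (i + j - 1) (circ P n m i x y) z =
        circ P n (m + l - 1) i x (circ P m l j y z)"
    and circ_ident_right:
      "\<lbrakk>1 \<le> i; i \<le> n; x \<in> carrier (cmp P n)\<rbrakk> \<Longrightarrow> circ P n 1 i x (ident P) = x"
    and circ_ident_left:
      "\<lbrakk>n \<ge> 1; x \<in> carrier (cmp P n)\<rbrakk> \<Longrightarrow> circ P 1 n 1 (ident P) x = x"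

locale ns_operad_morphism =
  source: ns_operad R P + target: ns_operad R Q
  for R :: "('k, 'r) ring_scheme" (structure)
    and P :: "('k, 'v) operad" and Q :: "('k, 'w) operad" +
  fixes f :: "nat \<Rightarrow> 'v \<Rightarrow> 'w"
  assumes map_linear: "n \<ge> 1 \<Longrightarrow> f n \<in> linear_maps R (cmp P n) (cmp Q n)"
    and map_circ:
      "\<lbrakk>1 \<le> i; i \<le> n; m \<ge> 1; x \<in> carrier (cmp P n); y \<in> carrier (cmp P m)\<rbrakk> \<Longrightarrow>
        f (n + m - 1) (circ P n m i x y) = circ Q n m i (f n x) (f m y)"
    and map_ident: "f 1 (ident P) = ident Q"

locale surjective_ns_operad_morphism = ns_operad_morphism +
  assumes map_surjective: "n \<ge> 1 \<Longrightarrow> f n ` carrier (cmp P n) = carrier (cmp Q n)"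


section \<open>Free modules and operads given on bases\<close>

text \<open>The free module on \<open>X\<close>: functions of finite support that vanish outside \<open>X\<close>. The fields
  \<open>mult\<close> and \<open>one\<close> of the record play no role in a module.\<close>

definition free_module :: "('k, 'r) ring_scheme \<Rightarrow> 'b set \<Rightarrow> ('k, 'b \<Rightarrow> 'k) module" where
  "free_module R X =
    \<lparr>carrier = {f. (\<forall>x\<in>X. f x \<in> carrier R) \<and> (\<forall>x. x \<notin> X \<longrightarrow> f x = \<zero>\<^bsub>R\<^esub>) \<and>
                   finite {x. f x \<noteq> \<zero>\<^bsub>R\<^esub>}},
     monoid.mult = (\<lambda>_ _. undefined), monoid.one = undefined,
     ring.zero = (\<lambda>_. \<zero>\<^bsub>R\<^esub>), ring.add = (\<lambda>f g x. f x \<oplus>\<^bsub>R\<^esub> g x),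
     smult = (\<lambda>c f x. c \<otimes>\<^bsub>R\<^esub> f x)\<rparr>"

definition basis_vec :: "('k, 'r) ring_scheme \<Rightarrow> 'b \<Rightarrow> 'b \<Rightarrow> 'k" where
  "basis_vec R x = (\<lambda>y. if y = x then \<one>\<^bsub>R\<^esub> else \<zero>\<^bsub>R\<^esub>)"

text \<open>The linear and bilinear extensions below sum over the whole basis; they are used only for
  finite bases.\<close>

definition linear_ext ::
  "('k, 'r) ring_scheme \<Rightarrow> 'b set \<Rightarrow> 'c set \<Rightarrow> ('b \<Rightarrow> 'c) \<Rightarrow> ('b \<Rightarrow> 'k) \<Rightarrow> 'c \<Rightarrow> 'k" where
  "linear_ext R X Z \<phi> u =
    (\<Oplus>\<^bsub>free_module R Z\<^esub>x\<in>X. u x \<odot>\<^bsub>free_module R Z\<^esub> basis_vec R (\<phi> x))"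

definition bilinear_ext ::
  "('k, 'r) ring_scheme \<Rightarrow> 'b set \<Rightarrow> 'c set \<Rightarrow> 'd set \<Rightarrow> ('b \<Rightarrow> 'c \<Rightarrow> 'd) \<Rightarrow>
    ('b \<Rightarrow> 'k) \<Rightarrow> ('c \<Rightarrow> 'k) \<Rightarrow> 'd \<Rightarrow> 'k" where
  "bilinear_ext R X Y Z \<beta> u v =
    (\<Oplus>\<^bsub>free_module R Z\<^esub>x\<in>X. \<Oplus>\<^bsub>free_module R Z\<^esub>y\<in>Y.
      (u x \<otimes>\<^bsub>R\<^esub> v y) \<odot>\<^bsub>free_module R Z\<^esub> basis_vec R (\<beta> x y))"

definition basis_operad ::
  "('k, 'r) ring_scheme \<Rightarrow> (nat \<Rightarrow> 'b set) \<Rightarrow> (nat \<Rightarrow> nat \<Rightarrow> nat \<Rightarrow> 'b \<Rightarrow> 'b \<Rightarrow> 'b) \<Rightarrow> 'b \<Rightarrow>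
    ('k, 'b \<Rightarrow> 'k) operad" where
  "basis_operad R X B e =
    \<lparr>cmp = (\<lambda>n. free_module R (X n)),
     circ = (\<lambda>n m i. bilinear_ext R (X n) (X m) (X (n + m - 1)) (B n m i)),
     ident = basis_vec R e\<rparr>"


section \<open>The operad of permutations\<close>

text \<open>A permutation is the list of its values: \<open>\<sigma>\<^sub>i\<close> is \<open>\<sigma> ! (i - 1)\<close>.\<close>

definition perms :: "nat \<Rightarrow> nat list set" where
  "perms n = permutations_of_set {1..n}"

definition perm_comp :: "nat \<Rightarrow> nat list \<Rightarrow> nat list \<Rightarrow> nat list" where
  "perm_comp i \<sigma> \<tau> =
    (let m = length \<tau>; v = \<sigma> ! (i - 1); a = (\<lambda>s. if s < v then s else s + m - 1)
     in map a (take (i - 1) \<sigma>) @ map (\<lambda>t. t + v - 1) \<tau> @ map a (drop i \<sigma>))"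

definition operad_A :: "('k, 'r) ring_scheme \<Rightarrow> ('k, nat list \<Rightarrow> 'k) operad" where
  "operad_A R = basis_operad R perms (\<lambda>n m. perm_comp) [1]"


section \<open>The operad of subsets\<close>

definition subsets :: "nat \<Rightarrow> nat set set" where
  "subsets n = Pow {1..n - 1}"

definition subset_comp :: "nat \<Rightarrow> nat \<Rightarrow> nat \<Rightarrow> nat set \<Rightarrow> nat set \<Rightarrow> nat set" where
  "subset_comp n m i S T =
    (S \<inter> {1..i - 1}) \<union> (\<lambda>t. t + i - 1) ` T \<union> (\<lambda>s. s + m - 1) ` (S \<inter> {i..n - 1})"

definition operad_Q :: "('k, 'r) ring_scheme \<Rightarrow> ('k, nat set \<Rightarrow> 'k) operad" where
  "operad_Q R = basis_operad R subsets subset_comp {}"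


section \<open>The operad of planar binary trees\<close>

text \<open>A planar binary tree is a \<open>unit tree\<close>; \<open>size\<close> counts the internal nodes (the \<open>Node\<close>s), and
  the leaves are the occurrences of \<open>Leaf\<close>.\<close>

definition trees :: "nat \<Rightarrow> unit tree set" where
  "trees n = {t. size t = n}"

abbreviation graft :: "unit tree \<Rightarrow> unit tree \<Rightarrow> unit tree" (infix \<open>\<or>\<^sub>t\<close> 55) where
  "s \<or>\<^sub>t t \<equiv> Node s () t"

text \<open>\<open>under s t\<close> glues \<open>t\<close> to the rightmost branch of \<open>s\<close> (often written s \ t), and \<open>over s t\<close>
  glues \<open>s\<close> to the leftmost branch of \<open>t\<close> (often written s / t).\<close>

fun under :: "unit tree \<Rightarrow> unit tree \<Rightarrow> unit tree" where
  "under Leaf t = t"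
| "under (Node l _ r) t = l \<or>\<^sub>t under r t"

fun over :: "unit tree \<Rightarrow> unit tree \<Rightarrow> unit tree" where
  "over s Leaf = s"
| "over s (Node l _ r) = over s l \<or>\<^sub>t r"

text \<open>The equation for \<open>Leaf\<close> is irrelevant: the first argument of a composition has arity at
  least 1.\<close>

fun tree_comp :: "nat \<Rightarrow> unit tree \<Rightarrow> unit tree \<Rightarrow> unit tree" where
  "tree_comp i Leaf t = Leaf"
| "tree_comp i (Node l _ r) t =
    (let j = size l + 1
     in if j < i then l \<or>\<^sub>t tree_comp (i - j) r t
        else if j = i then over l (left t) \<or>\<^sub>t under (right t) r
        else tree_comp i l t \<or>\<^sub>t r)"

definition operad_Y :: "('k, 'r) ring_scheme \<Rightarrow> ('k, unit tree \<Rightarrow> 'k) operad" where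
  "operad_Y R = basis_operad R trees (\<lambda>n m. tree_comp) (Leaf \<or>\<^sub>t Leaf)"


section \<open>The maps between the operads\<close>

definition st :: "nat list \<Rightarrow> nat list" where
  "st xs = map (\<lambda>x. card {y \<in> set xs. y \<le> x}) xs"

lemma length_st [simp]: "length (st xs) = length xs"
  by (simp add: st_def)

text \<open>The largest value of a permutation \<open>\<sigma>\<close> is \<open>length \<sigma>\<close>. The test \<open>length \<sigma> \<in> set \<sigma>\<close> is true for
  every nonempty permutation, false for the empty one, and ensures termination on arbitrary
  lists.\<close>

function perm_tree :: "nat list \<Rightarrow> unit tree" where
  "perm_tree \<sigma> =
    (if length \<sigma> \<in> set \<sigma>
     then perm_tree (st (takeWhile (\<lambda>x. x \<noteq> length \<sigma>) \<sigma>)) \<or>\<^sub>t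
          perm_tree (st (tl (dropWhile (\<lambda>x. x \<noteq> length \<sigma>) \<sigma>)))
     else Leaf)"
  by auto
termination
proof (relation "measure length", goal_cases)
  case 1
  show ?case by simp
next
  case (2 \<sigma>)
  have "takeWhile (\<lambda>x. x \<noteq> length \<sigma>) \<sigma> \<noteq> \<sigma>"
    using 2 by (metis (mono_tags) set_takeWhileD)
  then have "length (takeWhile (\<lambda>x. x \<noteq> length \<sigma>) \<sigma>) < length \<sigma>"
    by (metis le_neq_implies_less length_takeWhile_le takeWhile_eq_take take_all_iff order_refl)
  then show ?case by simp
next
  case (3 \<sigma>)
  have "length (dropWhile (\<lambda>x. x \<noteq> length \<sigma>) \<sigma>) \<le> length \<sigma>"
    by (rule length_dropWhile_le)
  moreover have "length \<sigma> > 0"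
    using 3 by (cases \<sigma>) auto
  ultimately show ?case by (simp del: length_greater_0_conv)
qed

declare perm_tree.simps [simp del]

definition Des :: "nat list \<Rightarrow> nat set" where
  "Des \<sigma> = {p \<in> {1..length \<sigma> - 1}. \<sigma> ! (p - 1) > \<sigma> ! p}"

text \<open>\<open>leaf_dirs d t\<close> records, for the leaves of \<open>t\<close> from left to right, whether the leaf is a left
  child; \<open>d\<close> says whether the root of \<open>t\<close> is itself a left child, which matters only if \<open>t\<close> is a
  leaf.\<close>

fun leaf_dirs :: "bool \<Rightarrow> unit tree \<Rightarrow> bool list" where
  "leaf_dirs d Leaf = [d]"
| "leaf_dirs d (Node l _ r) = leaf_dirs True l @ leaf_dirs False r"

text \<open>Counted from 0, the leaves of \<open>t\<close> are numbered \<open>0, \<dots>, size t\<close>, so removing the two outermost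
  ones leaves exactly \<open>1, \<dots>, size t - 1\<close>.\<close>

definition left_leaves :: "unit tree \<Rightarrow> nat set" where
  "left_leaves t = {p \<in> {1..size t - 1}. leaf_dirs True t ! p}"

definition map_Lambda ::
  "('k, 'r) ring_scheme \<Rightarrow> nat \<Rightarrow> (nat list \<Rightarrow> 'k) \<Rightarrow> unit tree \<Rightarrow> 'k" where
  "map_Lambda R n = linear_ext R (perms n) (trees n) perm_tree"

definition map_D :: "('k, 'r) ring_scheme \<Rightarrow> nat \<Rightarrow> (nat list \<Rightarrow> 'k) \<Rightarrow> nat set \<Rightarrow> 'k" where
  "map_D R n = linear_ext R (perms n) (subsets n) Des"

definition map_L :: "('k, 'r) ring_scheme \<Rightarrow> nat \<Rightarrow> (unit tree \<Rightarrow> 'k) \<Rightarrow> nat set \<Rightarrow> 'k" where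
  "map_L R n = linear_ext R (trees n) (subsets n) left_leaves"

end

theory Submission
  imports Defs
begin

text \<open>
  Everything reduces to bases. The compositions and the three maps are (bi)linear extensions of
  operations on finite sets, and (multi)linear maps are equal as soon as they agree on basis
  vectors. So it suffices to know that \<open>perms\<close>, \<open>trees\<close> and \<open>subsets\<close> satisfy the operad axioms as
  sets, that \<open>perm_tree\<close>, \<open>Des\<close> and \<open>left_leaves\<close> are surjective and respect the compositions, and
  that \<open>left_leaves\<close> after \<open>perm_tree\<close> is \<open>Des\<close>.

  Only permutations need their axioms checked by hand. In one-line notation, composing at position
  \<open>i\<close> splits the word as \<open>p @ v # q\<close> and replaces the letter \<open>v\<close> by a block of \<open>m\<close> consecutive values,
  after the values above \<open>v\<close> have made room for it; the axioms then compare the letters one by one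
  (\<open>perm_comp_parallel\<close>, \<open>perm_comp_sequential\<close>). Because \<open>perm_tree\<close> and \<open>Des\<close> are surjective and
  respect compositions, trees and subsets inherit the axioms as quotients
  (\<open>set_operad_surjection\<close>). For the same reason \<open>left_leaves\<close> needs no computation with trees: every
  tree comes from a permutation, and on permutations \<open>left_leaves\<close> becomes \<open>Des\<close>.

  What makes \<open>perm_tree\<close> compatible with the compositions is that the decreasing tree of a word
  depends only on the relative order of its letters and is built by splitting at the largest letter.
  Inflate a letter \<open>v\<close> to a block. As long as the largest letter is not \<open>v\<close>, it stays the largest and
  the split happens outside the block, which is the recursion of \<open>tree_comp\<close>. When \<open>v\<close> itself is the
  largest letter, the split happens inside the block, and the smaller letters on either side of it
  hang from the outer branches of the block's tree (\<open>dec_tree_insert\<close>).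

  Finally \<open>left_leaves (perm_tree \<sigma>) = Des \<sigma>\<close> because the inner leaf between two adjacent letters
  hangs from the smaller of the two: it points left exactly if the smaller one comes second, that is,
  at a descent (\<open>leaf_dirs_dec_tree\<close>).
\<close>

section \<open>Linear maps between free modules\<close>

lemma free_module_simps:
  "carrier (free_module R X) = {f. (\<forall>x\<in>X. f x \<in> carrier R) \<and> (\<forall>x. x \<notin> X \<longrightarrow> f x = \<zero>\<^bsub>R\<^esub>) \<and>
     finite {x. f x \<noteq> \<zero>\<^bsub>R\<^esub>}}"
  "\<zero>\<^bsub>free_module R X\<^esub> = (\<lambda>_. \<zero>\<^bsub>R\<^esub>)"
  "f \<oplus>\<^bsub>free_module R X\<^esub> g = (\<lambda>x. f x \<oplus>\<^bsub>R\<^esub> g x)"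
  "c \<odot>\<^bsub>free_module R X\<^esub> f = (\<lambda>x. c \<otimes>\<^bsub>R\<^esub> f x)"
  by (simp_all add: free_module_def)

context cring
begin

lemma free_module_apply_closed:
  assumes "f \<in> carrier (free_module R X)"
  shows "f x \<in> carrier R"
  using assms by (cases "x \<in> X") (auto simp: free_module_simps)

lemma free_module_add_closed:
  assumes "f \<in> carrier (free_module R X)" "g \<in> carrier (free_module R X)"
  shows "f \<oplus>\<^bsub>free_module R X\<^esub> g \<in> carrier (free_module R X)"
proof -
  have "{x. f x \<oplus> g x \<noteq> \<zero>} \<subseteq> {x. f x \<noteq> \<zero>} \<union> {x. g x \<noteq> \<zero>}"
    by auto
  then show ?thesis
    using assms by (auto simp: free_module_simps intro: finite_subset)
qed

lemma free_module_smult_closed: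
  assumes "c \<in> carrier R" "f \<in> carrier (free_module R X)"
  shows "c \<odot>\<^bsub>free_module R X\<^esub> f \<in> carrier (free_module R X)"
proof -
  have "{x. c \<otimes> f x \<noteq> \<zero>} \<subseteq> {x. f x \<noteq> \<zero>}"
    using assms(1) by auto
  then show ?thesis
    using assms by (auto simp: free_module_simps intro: finite_subset)
qed

lemma free_module_is_module: "Module.module R (free_module R X)"
proof (rule Module.module.intro)
  show "cring R" by (rule is_cring)
  show "abelian_group (free_module R X)"
  proof (rule abelian_groupI, goal_cases)
    case (6 f)
    then have "(\<lambda>x. \<ominus> f x) \<in> carrier (free_module R X)"
    proof -
      have "{x. \<ominus> f x \<noteq> \<zero>} \<subseteq> {x. f x \<noteq> \<zero>}"
        by auto
      then show ?thesis
        using 6 by (auto simp: free_module_simps intro: finite_subset)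
    qed
    moreover have "(\<lambda>x. \<ominus> f x) \<oplus>\<^bsub>free_module R X\<^esub> f = \<zero>\<^bsub>free_module R X\<^esub>"
      using free_module_apply_closed[OF 6] by (simp add: free_module_simps l_neg)
    ultimately show ?case by blast
  next
    case (3 f g h)
    then show ?case
      by (simp add: free_module_apply_closed[of _ X] free_module_simps(3) a_assoc)
  next
    case (4 f g)
    then show ?case
      by (simp add: free_module_apply_closed[of _ X] free_module_simps(3) a_comm)
  next
    case (5 f)
    then show ?case
      by (simp add: free_module_apply_closed[of _ X] free_module_simps(2,3))
  qed (simp_all add: free_module_add_closed, simp add: free_module_simps(1,2))
  show "module_axioms R (free_module R X)"
  proof (rule Module.module_axioms.intro, goal_cases)
    case (2 a b f)
    then show ?case
      by (simp add: free_module_apply_closed[of _ X] free_module_simps(3,4) l_distr)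
  next
    case (3 a f g)
    then show ?case
      by (simp add: free_module_apply_closed[of _ X] free_module_simps(3,4) r_distr)
  next
    case (4 a b f)
    then show ?case
      by (simp add: free_module_apply_closed[of _ X] free_module_simps(4) m_assoc)
  next
    case (5 f)
    then show ?case
      by (simp add: free_module_apply_closed[of _ X] free_module_simps(4))
  qed (rule free_module_smult_closed)
qed

lemma basis_vec_closed:
  assumes "x \<in> X"
  shows "basis_vec R x \<in> carrier (free_module R X)"
  using assms by (auto simp: free_module_simps basis_vec_def)

lemma linear_maps_comp:
  assumes "f \<in> linear_maps R L M" "g \<in> linear_maps R M N"
  shows "(\<lambda>x. g (f x)) \<in> linear_maps R L N"
  using assms by (auto simp: linear_maps_def Pi_iff)

lemma linear_maps_closed:
  assumes "f \<in> linear_maps R M N" "x \<in> carrier M"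
  shows "f x \<in> carrier N"
  using assms by (auto simp: linear_maps_def)

text \<open>The extensions in question are finite sums of elementary maps, so their linearity follows from
  that of the summands.\<close>

lemma linear_maps_finsum:
  assumes "Module.module R M" and "Module.module R N" and "finite A"
    and "\<And>a. a \<in> A \<Longrightarrow> f a \<in> linear_maps R M N"
  shows "(\<lambda>v. \<Oplus>\<^bsub>N\<^esub>a\<in>A. f a v) \<in> linear_maps R M N"
proof -
  interpret M: Module.module R M by fact
  interpret N: Module.module R N by fact
  show ?thesis
    using assms(3,4)
  proof (induction A rule: finite_induct)
    case empty
    then show ?case by (simp add: linear_maps_def)
  next
    case (insert a A)
    let ?s = "\<lambda>v. \<Oplus>\<^bsub>N\<^esub>b\<in>A. f b v"
    have s: "?s \<in> linear_maps R M N" and fa: "f a \<in> linear_maps R M N"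
      using insert by auto
    have eq: "(\<Oplus>\<^bsub>N\<^esub>b\<in>insert a A. f b v) = f a v \<oplus>\<^bsub>N\<^esub> ?s v" if "v \<in> carrier M" for v
      using insert.hyps insert.prems that by (intro N.finsum_insert) (auto intro: linear_maps_closed)
    note c = linear_maps_closed[OF s] linear_maps_closed[OF fa]
    have "f a (x \<oplus>\<^bsub>M\<^esub> y) \<oplus>\<^bsub>N\<^esub> ?s (x \<oplus>\<^bsub>M\<^esub> y) = (f a x \<oplus>\<^bsub>N\<^esub> ?s x) \<oplus>\<^bsub>N\<^esub> (f a y \<oplus>\<^bsub>N\<^esub> ?s y)"
      if "x \<in> carrier M" "y \<in> carrier M" for x y
    proof -
      have "f a (x \<oplus>\<^bsub>M\<^esub> y) = f a x \<oplus>\<^bsub>N\<^esub> f a y" "?s (x \<oplus>\<^bsub>M\<^esub> y) = ?s x \<oplus>\<^bsub>N\<^esub> ?s y"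
        using s fa that unfolding linear_maps_def by blast+
      then show ?thesis
        using c that by (simp add: N.a_ac)
    qed
    moreover have "f a (k \<odot>\<^bsub>M\<^esub> x) \<oplus>\<^bsub>N\<^esub> ?s (k \<odot>\<^bsub>M\<^esub> x) = k \<odot>\<^bsub>N\<^esub> (f a x \<oplus>\<^bsub>N\<^esub> ?s x)"
      if "k \<in> carrier R" "x \<in> carrier M" for k x
    proof -
      have "f a (k \<odot>\<^bsub>M\<^esub> x) = k \<odot>\<^bsub>N\<^esub> f a x" "?s (k \<odot>\<^bsub>M\<^esub> x) = k \<odot>\<^bsub>N\<^esub> ?s x"
        using s fa that unfolding linear_maps_def by blast+
      then show ?thesis
        using c that by (simp add: N.smult_r_distr)
    qed
    ultimately show ?case
      using c unfolding linear_maps_def by (simp add: eq Pi_iff)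
  qed
qed

lemma linear_maps_apply_finsum:
  assumes "Module.module R M" and "Module.module R N" and f: "f \<in> linear_maps R M N" and "finite A"
    and "\<And>a. a \<in> A \<Longrightarrow> w a \<in> carrier M"
  shows "f (\<Oplus>\<^bsub>M\<^esub>a\<in>A. w a) = (\<Oplus>\<^bsub>N\<^esub>a\<in>A. f (w a))"
proof -
  interpret M: Module.module R M by fact
  interpret N: Module.module R N by fact
  show ?thesis
    using assms(4,5)
  proof (induction A rule: finite_induct)
    case empty
    have "f (\<zero> \<odot>\<^bsub>M\<^esub> \<zero>\<^bsub>M\<^esub>) = \<zero> \<odot>\<^bsub>N\<^esub> f \<zero>\<^bsub>M\<^esub>"
      using f M.zero_closed zero_closed unfolding linear_maps_def by blast
    then show ?case
      using linear_maps_closed[OF f M.zero_closed] by simp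
  next
    case (insert a A)
    have "w a \<in> carrier M" "(\<Oplus>\<^bsub>M\<^esub>b\<in>A. w b) \<in> carrier M"
      using insert.prems by (auto intro: M.finsum_closed)
    then have "f (w a \<oplus>\<^bsub>M\<^esub> (\<Oplus>\<^bsub>M\<^esub>b\<in>A. w b)) = f (w a) \<oplus>\<^bsub>N\<^esub> f (\<Oplus>\<^bsub>M\<^esub>b\<in>A. w b)"
      using f unfolding linear_maps_def by blast
    then show ?case
      using insert f by (simp add: M.finsum_insert N.finsum_insert Pi_iff linear_maps_closed)
  qed
qed

lemma finsum_free_module_apply:
  assumes "finite A" and "\<And>a. a \<in> A \<Longrightarrow> w a \<in> carrier (free_module R X)"
  shows "(\<Oplus>\<^bsub>free_module R X\<^esub>a\<in>A. w a) z = (\<Oplus>a\<in>A. w a z)"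
proof -
  interpret M: Module.module R "free_module R X" by (rule free_module_is_module)
  show ?thesis
    using assms
  proof (induction A rule: finite_induct)
    case empty
    then show ?case by (simp add: free_module_simps(2))
  next
    case (insert a A)
    then show ?case
      by (simp add: M.finsum_insert finsum_insert Pi_iff free_module_apply_closed[of _ X] free_module_simps(3))
  qed
qed

lemma free_module_basis_expansion:
  assumes "finite X" and u: "u \<in> carrier (free_module R X)"
  shows "u = (\<Oplus>\<^bsub>free_module R X\<^esub>x\<in>X. u x \<odot>\<^bsub>free_module R X\<^esub> basis_vec R x)"
proof
  fix z
  have uc: "\<And>x. u x \<in> carrier R"
    using free_module_apply_closed[OF u] .
  have "(\<Oplus>\<^bsub>free_module R X\<^esub>x\<in>X. u x \<odot>\<^bsub>free_module R X\<^esub> basis_vec R x) z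
      = (\<Oplus>x\<in>X. (u x \<odot>\<^bsub>free_module R X\<^esub> basis_vec R x) z)"
    using assms(1) uc by (intro finsum_free_module_apply free_module_smult_closed basis_vec_closed)
  also have "\<dots> = (\<Oplus>x\<in>X. if z = x then u x else \<zero>)"
    using uc by (intro finsum_cong') (auto simp: free_module_simps(4) basis_vec_def)
  also have "\<dots> = u z"
  proof (cases "z \<in> X")
    case True
    then show ?thesis using assms(1) uc by (intro finsum_singleton) auto
  next
    case False
    then have "(\<Oplus>x\<in>X. if z = x then u x else \<zero>) = (\<Oplus>x\<in>X. \<zero>)"
      by (intro finsum_cong') auto
    then show ?thesis using False u by (simp add: free_module_simps(1))
  qed
  finally show "u z = (\<Oplus>\<^bsub>free_module R X\<^esub>x\<in>X. u x \<odot>\<^bsub>free_module R X\<^esub> basis_vec R x) z"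
    by simp
qed

lemma linear_maps_eqI:
  assumes X: "finite X" and N: "Module.module R N"
    and f: "f \<in> linear_maps R (free_module R X) N" and g: "g \<in> linear_maps R (free_module R X) N"
    and eq: "\<And>x. x \<in> X \<Longrightarrow> f (basis_vec R x) = g (basis_vec R x)"
    and u: "u \<in> carrier (free_module R X)"
  shows "f u = g u"
proof -
  interpret N: Module.module R N by fact
  have uc: "\<And>x. u x \<in> carrier R"
    using free_module_apply_closed[OF u] .
  have *: "h u = (\<Oplus>\<^bsub>N\<^esub>x\<in>X. u x \<odot>\<^bsub>N\<^esub> h (basis_vec R x))"
    if h: "h \<in> linear_maps R (free_module R X) N" for h
  proof -
    have "h u = h (\<Oplus>\<^bsub>free_module R X\<^esub>x\<in>X. u x \<odot>\<^bsub>free_module R X\<^esub> basis_vec R x)"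
      using free_module_basis_expansion[OF X u] by simp
    also have "\<dots> = (\<Oplus>\<^bsub>N\<^esub>x\<in>X. h (u x \<odot>\<^bsub>free_module R X\<^esub> basis_vec R x))"
      using uc by (intro linear_maps_apply_finsum[OF free_module_is_module N h X]
          free_module_smult_closed basis_vec_closed)
    also have "\<dots> = (\<Oplus>\<^bsub>N\<^esub>x\<in>X. u x \<odot>\<^bsub>N\<^esub> h (basis_vec R x))"
    proof (intro N.finsum_cong')
      show "(\<lambda>x. u x \<odot>\<^bsub>N\<^esub> h (basis_vec R x)) \<in> X \<rightarrow> carrier N"
        using uc by (auto intro!: N.smult_closed linear_maps_closed[OF h] basis_vec_closed)
      show "h (u x \<odot>\<^bsub>free_module R X\<^esub> basis_vec R x) = u x \<odot>\<^bsub>N\<^esub> h (basis_vec R x)" if "x \<in> X" for x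
        using h uc basis_vec_closed[OF that] unfolding linear_maps_def by blast
    qed simp
    finally show ?thesis .
  qed
  show ?thesis
    unfolding *[OF f] *[OF g] using eq uc
    by (intro N.finsum_cong') (auto intro!: N.smult_closed linear_maps_closed[OF g] basis_vec_closed)
qed

text \<open>Arguments are replaced by basis vectors one at a time: with all other arguments fixed, both sides
  are linear in the remaining one.\<close>

lemma bilinear_eqI:
  assumes "finite X" and "finite Y" and N: "Module.module R N"
    and left: "\<And>v. v \<in> carrier (free_module R Y) \<Longrightarrow> (\<lambda>u. f u v) \<in> linear_maps R (free_module R X) N"
      "\<And>v. v \<in> carrier (free_module R Y) \<Longrightarrow> (\<lambda>u. g u v) \<in> linear_maps R (free_module R X) N"
    and right: "\<And>u. u \<in> carrier (free_module R X) \<Longrightarrow> f u \<in> linear_maps R (free_module R Y) N"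
      "\<And>u. u \<in> carrier (free_module R X) \<Longrightarrow> g u \<in> linear_maps R (free_module R Y) N"
    and eq: "\<And>x y. x \<in> X \<Longrightarrow> y \<in> Y \<Longrightarrow> f (basis_vec R x) (basis_vec R y) = g (basis_vec R x) (basis_vec R y)"
    and u: "u \<in> carrier (free_module R X)" and v: "v \<in> carrier (free_module R Y)"
  shows "f u v = g u v"
proof (rule linear_maps_eqI[OF assms(1) N left(1)[OF v] left(2)[OF v] _ u])
  fix x assume x: "x \<in> X"
  show "f (basis_vec R x) v = g (basis_vec R x) v"
    by (rule linear_maps_eqI[OF assms(2) N right(1) right(2) eq v]) (rule basis_vec_closed x | assumption)+
qed

lemma trilinear_eqI:
  assumes "finite X" and "finite Y" and "finite Z" and N: "Module.module R N"
    and first: "\<And>v w. \<lbrakk>v \<in> carrier (free_module R Y); w \<in> carrier (free_module R Z)\<rbrakk> \<Longrightarrow>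
        (\<lambda>u. f u v w) \<in> linear_maps R (free_module R X) N"
      "\<And>v w. \<lbrakk>v \<in> carrier (free_module R Y); w \<in> carrier (free_module R Z)\<rbrakk> \<Longrightarrow>
        (\<lambda>u. g u v w) \<in> linear_maps R (free_module R X) N"
    and second: "\<And>u w. \<lbrakk>u \<in> carrier (free_module R X); w \<in> carrier (free_module R Z)\<rbrakk> \<Longrightarrow>
        (\<lambda>v. f u v w) \<in> linear_maps R (free_module R Y) N"
      "\<And>u w. \<lbrakk>u \<in> carrier (free_module R X); w \<in> carrier (free_module R Z)\<rbrakk> \<Longrightarrow>
        (\<lambda>v. g u v w) \<in> linear_maps R (free_module R Y) N"
    and third: "\<And>u v. \<lbrakk>u \<in> carrier (free_module R X); v \<in> carrier (free_module R Y)\<rbrakk> \<Longrightarrow>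
        f u v \<in> linear_maps R (free_module R Z) N"
      "\<And>u v. \<lbrakk>u \<in> carrier (free_module R X); v \<in> carrier (free_module R Y)\<rbrakk> \<Longrightarrow>
        g u v \<in> linear_maps R (free_module R Z) N"
    and eq: "\<And>x y z. \<lbrakk>x \<in> X; y \<in> Y; z \<in> Z\<rbrakk> \<Longrightarrow>
        f (basis_vec R x) (basis_vec R y) (basis_vec R z) = g (basis_vec R x) (basis_vec R y) (basis_vec R z)"
    and u: "u \<in> carrier (free_module R X)" and v: "v \<in> carrier (free_module R Y)"
    and w: "w \<in> carrier (free_module R Z)"
  shows "f u v w = g u v w"
proof (rule linear_maps_eqI[OF assms(1) N first(1)[OF v w] first(2)[OF v w] _ u])
  fix x assume x: "x \<in> X"
  have bx: "basis_vec R x \<in> carrier (free_module R X)"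
    using x by (rule basis_vec_closed)
  show "f (basis_vec R x) v w = g (basis_vec R x) v w"
    by (rule bilinear_eqI[OF assms(2,3) N second(1)[OF bx] second(2)[OF bx]
          third(1)[OF bx] third(2)[OF bx] eq[OF x] v w])
qed

text \<open>Every \<open>linear_ext\<close> is a sum of such maps.\<close>

lemma coefficient_linear:
  assumes "Module.module R M" and "b \<in> carrier M"
  shows "(\<lambda>u. u x \<odot>\<^bsub>M\<^esub> b) \<in> linear_maps R (free_module R X) M"
proof -
  interpret M: Module.module R M by fact
  show ?thesis
    unfolding linear_maps_def using assms(2)
    by (simp add: Pi_iff free_module_apply_closed[of _ X] free_module_simps(3,4)
        M.smult_l_distr M.smult_assoc1)
qed

lemma linear_ext_linear:
  assumes "finite X" and "\<And>x. x \<in> X \<Longrightarrow> \<phi> x \<in> Z"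
  shows "linear_ext R X Z \<phi> \<in> linear_maps R (free_module R X) (free_module R Z)"
  unfolding linear_ext_def using assms
  by (intro linear_maps_finsum free_module_is_module coefficient_linear basis_vec_closed)

text \<open>A sum weighted by the coefficients of a basis vector has a single nonzero term; this evaluates
  linear and bilinear extensions on the basis.\<close>

lemma finsum_basis_vec:
  assumes M: "Module.module R M" and "finite X" and "x \<in> X"
    and w: "\<And>y. y \<in> X \<Longrightarrow> w y \<in> carrier M"
  shows "(\<Oplus>\<^bsub>M\<^esub>y\<in>X. basis_vec R x y \<odot>\<^bsub>M\<^esub> w y) = w x"
proof -
  interpret M: Module.module R M by fact
  have "(\<Oplus>\<^bsub>M\<^esub>y\<in>X. basis_vec R x y \<odot>\<^bsub>M\<^esub> w y) = (\<Oplus>\<^bsub>M\<^esub>y\<in>X. if x = y then w y else \<zero>\<^bsub>M\<^esub>)"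
    using w by (intro M.finsum_cong') (auto simp: basis_vec_def)
  also have "\<dots> = w x"
    using assms by (intro M.finsum_singleton) auto
  finally show ?thesis .
qed

lemma linear_ext_basis:
  assumes "finite X" and "\<And>x. x \<in> X \<Longrightarrow> \<phi> x \<in> Z" and "x \<in> X"
  shows "linear_ext R X Z \<phi> (basis_vec R x) = basis_vec R (\<phi> x)"
  unfolding linear_ext_def using assms
  by (intro finsum_basis_vec free_module_is_module basis_vec_closed)

text \<open>Fixing one argument of a bilinear extension and summing over its basis leaves a sum of
  multiples of coefficient functionals of the other argument, hence a linear map.\<close>

lemma bilinear_ext_linear_left:
  assumes "finite X" and "finite Y" and \<beta>: "\<And>x y. x \<in> X \<Longrightarrow> y \<in> Y \<Longrightarrow> \<beta> x y \<in> Z"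
    and v: "v \<in> carrier (free_module R Y)"
  shows "(\<lambda>u. bilinear_ext R X Y Z \<beta> u v) \<in> linear_maps R (free_module R X) (free_module R Z)"
  unfolding bilinear_ext_def
proof (intro linear_maps_finsum free_module_is_module assms(1,2))
  fix x y assume xy: "x \<in> X" "y \<in> Y"
  interpret M: Module.module R "free_module R Z" by (rule free_module_is_module)
  have vy: "v y \<in> carrier R" using free_module_apply_closed[OF v] .
  have b: "basis_vec R (\<beta> x y) \<in> carrier (free_module R Z)"
    using \<beta>[OF xy] by (rule basis_vec_closed)
  show "(\<lambda>u. (u x \<otimes> v y) \<odot>\<^bsub>free_module R Z\<^esub> basis_vec R (\<beta> x y))
      \<in> linear_maps R (free_module R X) (free_module R Z)"
    using b vy unfolding linear_maps_def
    by (simp add: Pi_iff free_module_apply_closed[of _ X] free_module_simps(3,4)[of R X]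
        M.smult_l_distr M.smult_assoc1 l_distr)
qed

lemma bilinear_ext_linear_right:
  assumes "finite X" and "finite Y" and \<beta>: "\<And>x y. x \<in> X \<Longrightarrow> y \<in> Y \<Longrightarrow> \<beta> x y \<in> Z"
    and u: "u \<in> carrier (free_module R X)"
  shows "bilinear_ext R X Y Z \<beta> u \<in> linear_maps R (free_module R Y) (free_module R Z)"
  unfolding bilinear_ext_def
proof (intro linear_maps_finsum free_module_is_module assms(1,2))
  fix x y assume xy: "x \<in> X" "y \<in> Y"
  interpret M: Module.module R "free_module R Z" by (rule free_module_is_module)
  have ux: "u x \<in> carrier R" using free_module_apply_closed[OF u] .
  have b: "basis_vec R (\<beta> x y) \<in> carrier (free_module R Z)"
    using \<beta>[OF xy] by (rule basis_vec_closed)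
  have *: "(u x \<otimes> (c \<otimes> a)) = c \<otimes> (u x \<otimes> a)" if "c \<in> carrier R" "a \<in> carrier R" for c a
    using ux that by (simp add: m_lcomm)
  show "(\<lambda>v. (u x \<otimes> v y) \<odot>\<^bsub>free_module R Z\<^esub> basis_vec R (\<beta> x y))
      \<in> linear_maps R (free_module R Y) (free_module R Z)"
    using b ux unfolding linear_maps_def
    by (simp add: Pi_iff free_module_apply_closed[of _ Y] free_module_simps(3,4)[of R Y]
        M.smult_l_distr M.smult_assoc1[symmetric] r_distr *)
qed

lemma bilinear_ext_basis:
  assumes "finite X" and "finite Y" and \<beta>: "\<And>x y. x \<in> X \<Longrightarrow> y \<in> Y \<Longrightarrow> \<beta> x y \<in> Z"
    and "x \<in> X" and "y \<in> Y"
  shows "bilinear_ext R X Y Z \<beta> (basis_vec R x) (basis_vec R y) = basis_vec R (\<beta> x y)"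
proof -
  interpret M: Module.module R "free_module R Z" by (rule free_module_is_module)
  have b: "basis_vec R (\<beta> x' y') \<in> carrier (free_module R Z)" if "x' \<in> X" "y' \<in> Y" for x' y'
    using \<beta>[OF that] by (rule basis_vec_closed)
  have coeff: "basis_vec R x x' \<in> carrier R" "basis_vec R y y' \<in> carrier R" for x' y'
    by (simp_all add: basis_vec_def)
  have "bilinear_ext R X Y Z \<beta> (basis_vec R x) (basis_vec R y) =
      (\<Oplus>\<^bsub>free_module R Z\<^esub>x'\<in>X. basis_vec R x x' \<odot>\<^bsub>free_module R Z\<^esub>
        (\<Oplus>\<^bsub>free_module R Z\<^esub>y'\<in>Y. basis_vec R y y' \<odot>\<^bsub>free_module R Z\<^esub> basis_vec R (\<beta> x' y')))"
    unfolding bilinear_ext_def using b coeff assms(2)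
    by (intro M.finsum_cong')
      (auto simp: M.smult_assoc1 M.finsum_smult_ldistr Pi_iff intro!: M.finsum_closed M.finsum_cong')
  also have "\<dots> = (\<Oplus>\<^bsub>free_module R Z\<^esub>x'\<in>X. basis_vec R x x' \<odot>\<^bsub>free_module R Z\<^esub> basis_vec R (\<beta> x' y))"
    using assms b by (intro M.finsum_cong' arg_cong[where f = "\<lambda>w. _ \<odot>\<^bsub>_\<^esub> w"] finsum_basis_vec)
      (auto simp: coeff intro!: M.smult_closed free_module_is_module)
  also have "\<dots> = basis_vec R (\<beta> x y)"
    using assms b by (intro finsum_basis_vec free_module_is_module) auto
  finally show ?thesis .
qed

end

section \<open>Operads spanned by a basis\<close>

text \<open>The axioms of a non-symmetric operad for sets instead of modules. The finiteness of the sets makes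
  the sums in \<open>linear_ext\<close> and \<open>bilinear_ext\<close> meaningful.\<close>

locale set_operad =
  fixes X :: "nat \<Rightarrow> 'b set" and B :: "nat \<Rightarrow> nat \<Rightarrow> nat \<Rightarrow> 'b \<Rightarrow> 'b \<Rightarrow> 'b" and e :: 'b
  assumes fin: "n \<ge> 1 \<Longrightarrow> finite (X n)"
    and closed: "\<lbrakk>1 \<le> i; i \<le> n; m \<ge> 1; x \<in> X n; y \<in> X m\<rbrakk> \<Longrightarrow> B n m i x y \<in> X (n + m - 1)"
    and unit_closed: "e \<in> X 1"
    and parallel: "\<lbrakk>1 \<le> i; i < j; j \<le> n; m \<ge> 1; l \<ge> 1; x \<in> X n; y \<in> X m; z \<in> X l\<rbrakk> \<Longrightarrow>
      B (n + m - 1) l (j + m - 1) (B n m i x y) z = B (n + l - 1) m i (B n l j x z) y"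
    and sequential: "\<lbrakk>1 \<le> i; i \<le> n; 1 \<le> j; j \<le> m; l \<ge> 1; x \<in> X n; y \<in> X m; z \<in> X l\<rbrakk> \<Longrightarrow>
      B (n + m - 1) l (i + j - 1) (B n m i x y) z = B n (m + l - 1) i x (B m l j y z)"
    and unit_right: "\<lbrakk>1 \<le> i; i \<le> n; x \<in> X n\<rbrakk> \<Longrightarrow> B n 1 i x e = x"
    and unit_left: "\<lbrakk>n \<ge> 1; x \<in> X n\<rbrakk> \<Longrightarrow> B 1 n 1 e x = x"
begin

lemma ns_operad_basis_operad:
  fixes R :: "('k, 'r) ring_scheme"
  assumes "cring R"
  shows "ns_operad R (basis_operad R X B e)"
proof -
  interpret cring R by fact
  let ?F = "\<lambda>n. free_module R (X n)"
  let ?c = "\<lambda>n m i. bilinear_ext R (X n) (X m) (X (n + m - 1)) (B n m i)"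
  have left: "(\<lambda>x. ?c n m i x y) \<in> linear_maps R (?F n) (?F (n + m - 1))"
    if "1 \<le> i" "i \<le> n" "m \<ge> 1" "y \<in> carrier (?F m)" for i n m y
    using that by (intro bilinear_ext_linear_left fin closed) auto
  have right: "?c n m i x \<in> linear_maps R (?F m) (?F (n + m - 1))"
    if "1 \<le> i" "i \<le> n" "m \<ge> 1" "x \<in> carrier (?F n)" for i n m x
    using that by (intro bilinear_ext_linear_right fin closed) auto
  have basis: "?c n m i (basis_vec R x) (basis_vec R y) = basis_vec R (B n m i x y)"
    if "1 \<le> i" "i \<le> n" "m \<ge> 1" "x \<in> X n" "y \<in> X m" for i n m x y
    using that by (intro bilinear_ext_basis fin closed) auto
  have e: "basis_vec R e \<in> carrier (?F 1)"
    by (intro basis_vec_closed unit_closed)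
  have cc: "?c n m i x y \<in> carrier (?F (n + m - 1))"
    if "1 \<le> i" "i \<le> n" "m \<ge> 1" "x \<in> carrier (?F n)" "y \<in> carrier (?F m)" for i n m x y
    using linear_maps_closed[OF right] that by blast
  have id_lin: "(\<lambda>x. x) \<in> linear_maps R (?F n) (?F n)" for n
    by (simp add: linear_maps_def)
  show ?thesis
    unfolding basis_operad_def
  proof (intro ns_operad.intro ns_operad_axioms.intro is_cring, unfold operad.simps, goal_cases)
    case (1 n)
    show ?case by (rule free_module_is_module)
  next
    case (2 i n m y)
    then show ?case by (rule left)
  next
    case (3 i n m x)
    then show ?case by (rule right)
  next
    case 4
    show ?case by (rule e)
  next
    case (5 i j n m l x y z)
    note a = 5(1-5)
    have ar: "n + m - 1 + l - 1 = n + l - 1 + m - 1"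
      using a by simp
    have J: "1 \<le> j + m - 1" "j + m - 1 \<le> n + m - 1" and I: "i \<le> n" "i \<le> n + l - 1" "1 \<le> j"
      using a by auto
    have fn: "finite (X n)" "finite (X m)" "finite (X l)"
      using a by (auto intro!: fin)
    let ?l = "\<lambda>x y z. ?c (n + m - 1) l (j + m - 1) (?c n m i x y) z"
    let ?r = "\<lambda>x y z. ?c (n + l - 1) m i (?c n l j x z) y"
    let ?T = "?F (n + l - 1 + m - 1)"
    have b: "?l (basis_vec R x) (basis_vec R y) (basis_vec R z) =
        ?r (basis_vec R x) (basis_vec R y) (basis_vec R z)" if "x \<in> X n" "y \<in> X m" "z \<in> X l" for x y z
      using a I J that by (simp only: basis closed parallel)
    have lx: "(\<lambda>x. ?l x y z) \<in> linear_maps R (?F n) ?T" "(\<lambda>x. ?r x y z) \<in> linear_maps R (?F n) ?T"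
      if "y \<in> carrier (?F m)" "z \<in> carrier (?F l)" for y z
      using linear_maps_comp[OF left[of i n m y] left[of "j + m - 1" "n + m - 1" l z]]
        linear_maps_comp[OF left[of j n l z] left[of i "n + l - 1" m y]] a I J that
      unfolding ar by blast+
    have ly: "(\<lambda>y. ?l x y z) \<in> linear_maps R (?F m) ?T" "(\<lambda>y. ?r x y z) \<in> linear_maps R (?F m) ?T"
      if "x \<in> carrier (?F n)" "z \<in> carrier (?F l)" for x z
      using linear_maps_comp[OF right[of i n m x] left[of "j + m - 1" "n + m - 1" l z]]
        right[of i "n + l - 1" m "?c n l j x z"] cc[of j n l x z] a I J that
      unfolding ar by blast+
    have lz: "(\<lambda>z. ?l x y z) \<in> linear_maps R (?F l) ?T" "(\<lambda>z. ?r x y z) \<in> linear_maps R (?F l) ?T"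
      if "x \<in> carrier (?F n)" "y \<in> carrier (?F m)" for x y
      using right[of "j + m - 1" "n + m - 1" l "?c n m i x y"] cc[of i n m x y]
        linear_maps_comp[OF right[of j n l x] left[of i "n + l - 1" m y]] a I J that
      unfolding ar by blast+
    show ?case
      by (rule trilinear_eqI[where f = ?l and g = ?r, OF fn free_module_is_module lx ly lz b 5(6-8)])
  next
    case (6 i n j m l x y z)
    note a = 6(1-5)
    have ar: "n + (m + l - 1) - 1 = n + m - 1 + l - 1"
      using a by simp
    have J: "1 \<le> i + j - 1" "i + j - 1 \<le> n + m - 1" and I: "1 \<le> m" "1 \<le> m + l - 1"
      using a by auto
    have fn: "finite (X n)" "finite (X m)" "finite (X l)"
      using a by (auto intro!: fin)
    let ?l = "\<lambda>x y z. ?c (n + m - 1) l (i + j - 1) (?c n m i x y) z"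
    let ?r = "\<lambda>x y z. ?c n (m + l - 1) i x (?c m l j y z)"
    let ?T = "?F (n + m - 1 + l - 1)"
    have b: "?l (basis_vec R x) (basis_vec R y) (basis_vec R z) =
        ?r (basis_vec R x) (basis_vec R y) (basis_vec R z)" if "x \<in> X n" "y \<in> X m" "z \<in> X l" for x y z
      using a I J that by (simp only: basis closed sequential)
    have lx: "(\<lambda>x. ?l x y z) \<in> linear_maps R (?F n) ?T" "(\<lambda>x. ?r x y z) \<in> linear_maps R (?F n) ?T"
      if "y \<in> carrier (?F m)" "z \<in> carrier (?F l)" for y z
      using linear_maps_comp[OF left[of i n m y] left[of "i + j - 1" "n + m - 1" l z]]
        left[of i n "m + l - 1" "?c m l j y z"] cc[of j m l y z] a I J that
      unfolding ar by blast+
    have ly: "(\<lambda>y. ?l x y z) \<in> linear_maps R (?F m) ?T" "(\<lambda>y. ?r x y z) \<in> linear_maps R (?F m) ?T"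
      if "x \<in> carrier (?F n)" "z \<in> carrier (?F l)" for x z
      using linear_maps_comp[OF right[of i n m x] left[of "i + j - 1" "n + m - 1" l z]]
        linear_maps_comp[OF left[of j m l z] right[of i n "m + l - 1" x]] a I J that
      unfolding ar by blast+
    have lz: "(\<lambda>z. ?l x y z) \<in> linear_maps R (?F l) ?T" "(\<lambda>z. ?r x y z) \<in> linear_maps R (?F l) ?T"
      if "x \<in> carrier (?F n)" "y \<in> carrier (?F m)" for x y
      using right[of "i + j - 1" "n + m - 1" l "?c n m i x y"] cc[of i n m x y]
        linear_maps_comp[OF right[of j m l y] right[of i n "m + l - 1" x]] a I J that
      unfolding ar by blast+
    show ?case
      by (rule trilinear_eqI[where f = ?l and g = ?r, OF fn free_module_is_module lx ly lz b 6(6-8)])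
  next
    case (7 i n x)
    have "?c n 1 i (basis_vec R b) (basis_vec R e) = basis_vec R b" if "b \<in> X n" for b
      using 7 that basis[of i n 1 b e] unit_closed unit_right by simp
    moreover have n: "finite (X n)"
      using 7 by (intro fin) auto
    moreover have "(\<lambda>x. ?c n 1 i x (basis_vec R e)) \<in> linear_maps R (?F n) (?F n)"
      using 7 e left[of i n 1 "basis_vec R e"] by simp
    ultimately show ?case
      using 7 linear_maps_eqI[OF n free_module_is_module _ id_lin, of "\<lambda>x. ?c n 1 i x (basis_vec R e)"] by blast
  next
    case (8 n x)
    have "?c 1 n 1 (basis_vec R e) (basis_vec R b) = basis_vec R b" if "b \<in> X n" for b
      using 8 that basis[of 1 1 n e b] unit_closed unit_left by simp
    moreover have n: "finite (X n)"
      using 8 by (intro fin) auto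
    moreover have "?c 1 n 1 (basis_vec R e) \<in> linear_maps R (?F n) (?F n)"
      using 8 e right[of 1 1 n "basis_vec R e"] by simp
    ultimately show ?case
      using 8 linear_maps_eqI[OF n free_module_is_module _ id_lin, of "?c 1 n 1 (basis_vec R e)"] by blast
  qed
qed

end

text \<open>Every element of \<open>Y\<close> lifts to \<open>X\<close>, and \<open>\<phi>\<close> carries an axiom for the lifts to the axiom for the
  elements. So \<open>Y\<close> inherits the axioms without any computation in \<open>Y\<close>.\<close>

lemma set_operad_surjection:
  assumes "set_operad X B e"
    and surj: "\<And>n. n \<ge> 1 \<Longrightarrow> \<phi> n ` X n = Y n"
    and hom: "\<And>i n m x y. \<lbrakk>1 \<le> i; i \<le> n; m \<ge> 1; x \<in> X n; y \<in> X m\<rbrakk> \<Longrightarrow>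
      \<phi> (n + m - 1) (B n m i x y) = C n m i (\<phi> n x) (\<phi> m y)"
    and unit: "\<phi> 1 e = e'"
  shows "set_operad Y C e'"
proof -
  interpret X: set_operad X B e by fact
  have pre: "\<exists>x\<in>X n. y = \<phi> n x" if "n \<ge> 1" "y \<in> Y n" for n y
    using surj[OF that(1)] that(2) by blast
  have in_Y: "\<phi> n x \<in> Y n" if "n \<ge> 1" "x \<in> X n" for n x
    using surj[OF that(1)] that(2) by blast
  show ?thesis
  proof (unfold_locales, goal_cases)
    case (1 n)
    then show ?case using X.fin surj by (metis finite_imageI)
  next
    case (2 i n m x y)
    then obtain x' y' where "x' \<in> X n" "x = \<phi> n x'" "y' \<in> X m" "y = \<phi> m y'"
      using pre[of n x] pre[of m y] by auto
    then show ?case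
      using 2 X.closed[of i n m x' y'] in_Y[of "n + m - 1"] by (simp flip: hom)
  next
    case 3
    show ?case using in_Y[OF _ X.unit_closed] unit by simp
  next
    case (4 i j n m l x y z)
    then obtain x' y' z' where *: "x' \<in> X n" "x = \<phi> n x'" "y' \<in> X m" "y = \<phi> m y'"
        "z' \<in> X l" "z = \<phi> l z'"
      using pre[of n x] pre[of m y] pre[of l z] by auto
    have ar: "n + l - 1 + m - 1 = n + m - 1 + l - 1"
      using 4 by simp
    have J: "1 \<le> j + m - 1" "j + m - 1 \<le> n + m - 1" "1 \<le> j" "i \<le> n" "i \<le> n + l - 1"
      using 4 by auto
    have "C (n + m - 1) l (j + m - 1) (C n m i x y) z =
        \<phi> (n + m - 1 + l - 1) (B (n + m - 1) l (j + m - 1) (B n m i x' y') z')"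
      unfolding *(2,4,6) hom[OF J(1,2) 4(5) X.closed[OF 4(1) J(4) 4(4) *(1,3)] *(5)]
        hom[OF 4(1) J(4) 4(4) *(1,3)] ..
    also have "\<dots> = \<phi> (n + l - 1 + m - 1) (B (n + l - 1) m i (B n l j x' z') y')"
      unfolding ar X.parallel[OF 4(1-5) *(1,3,5)] ..
    also have "\<dots> = C (n + l - 1) m i (C n l j x z) y"
      unfolding *(2,4,6) hom[OF 4(1) J(5) 4(4) X.closed[OF J(3) 4(3) 4(5) *(1,5)] *(3)]
        hom[OF J(3) 4(3) 4(5) *(1,5)] ..
    finally show ?case .
  next
    case (5 i n j m l x y z)
    then obtain x' y' z' where *: "x' \<in> X n" "x = \<phi> n x'" "y' \<in> X m" "y = \<phi> m y'"
        "z' \<in> X l" "z = \<phi> l z'"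
      using pre[of n x] pre[of m y] pre[of l z] by auto
    have ar: "n + m - 1 + l - 1 = n + (m + l - 1) - 1"
      using 5 by simp
    have J: "1 \<le> i + j - 1" "i + j - 1 \<le> n + m - 1" "1 \<le> m" "1 \<le> m + l - 1"
      using 5 by auto
    have "C (n + m - 1) l (i + j - 1) (C n m i x y) z =
        \<phi> (n + m - 1 + l - 1) (B (n + m - 1) l (i + j - 1) (B n m i x' y') z')"
      unfolding *(2,4,6) hom[OF J(1,2) 5(5) X.closed[OF 5(1,2) J(3) *(1,3)] *(5)]
        hom[OF 5(1,2) J(3) *(1,3)] ..
    also have "\<dots> = \<phi> (n + (m + l - 1) - 1) (B n (m + l - 1) i x' (B m l j y' z'))"
      unfolding ar X.sequential[OF 5(1-5) *(1,3,5)] ..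
    also have "\<dots> = C n (m + l - 1) i x (C m l j y z)"
      unfolding *(2,4,6) hom[OF 5(1,2) J(4) *(1) X.closed[OF 5(3-5) *(3,5)]]
        hom[OF 5(3-5) *(3,5)] ..
    finally show ?case .
  next
    case (6 i n x)
    then obtain x' where "x' \<in> X n" "x = \<phi> n x'"
      using pre[of n x] by auto
    then show ?case
      using 6 hom[of i n 1 x' e] X.unit_closed X.unit_right unit by simp
  next
    case (7 n x)
    then obtain x' where "x' \<in> X n" "x = \<phi> n x'"
      using pre[of n x] by auto
    then show ?case
      using 7 hom[of 1 1 n e x'] X.unit_closed X.unit_left unit by simp
  qed
qed

lemma surjective_ns_operad_morphism_linear_ext:
  fixes R :: "('k, 'r) ring_scheme"
  assumes "cring R" and "set_operad X B e" and "set_operad Y C e'"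
    and surj: "\<And>n. n \<ge> 1 \<Longrightarrow> \<phi> n ` X n = Y n"
    and hom: "\<And>i n m x y. \<lbrakk>1 \<le> i; i \<le> n; m \<ge> 1; x \<in> X n; y \<in> X m\<rbrakk> \<Longrightarrow>
      \<phi> (n + m - 1) (B n m i x y) = C n m i (\<phi> n x) (\<phi> m y)"
    and unit: "\<phi> 1 e = e'"
  shows "surjective_ns_operad_morphism R (basis_operad R X B e) (basis_operad R Y C e')
    (\<lambda>n. linear_ext R (X n) (Y n) (\<phi> n))"
proof -
  interpret cring R by fact
  interpret X: set_operad X B e by fact
  interpret Y: set_operad Y C e' by fact
  let ?F = "\<lambda>n. free_module R (X n)" and ?G = "\<lambda>n. free_module R (Y n)"
  let ?f = "\<lambda>n. linear_ext R (X n) (Y n) (\<phi> n)"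
  let ?b = "\<lambda>n m i. bilinear_ext R (X n) (X m) (X (n + m - 1)) (B n m i)"
  let ?c = "\<lambda>n m i. bilinear_ext R (Y n) (Y m) (Y (n + m - 1)) (C n m i)"
  have in_Y: "\<phi> n x \<in> Y n" if "n \<ge> 1" "x \<in> X n" for n x
    using surj[OF that(1)] that(2) by blast
  have f: "?f n \<in> linear_maps R (?F n) (?G n)" if "n \<ge> 1" for n
    using that in_Y X.fin by (intro linear_ext_linear) auto
  have f_basis: "?f n (basis_vec R x) = basis_vec R (\<phi> n x)" if "n \<ge> 1" "x \<in> X n" for n x
    using that in_Y X.fin by (intro linear_ext_basis) auto
  have f_circ: "?f (n + m - 1) (?b n m i u v) = ?c n m i (?f n u) (?f m v)"
    if a: "1 \<le> i" "i \<le> n" "m \<ge> 1" and u: "u \<in> carrier (?F n)" and v: "v \<in> carrier (?F m)" for i n m u v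
  proof -
    have n: "n \<ge> 1" "n + m - 1 \<ge> 1"
      using a by auto
    have bl: "(\<lambda>u. ?b n m i u v) \<in> linear_maps R (?F n) (?F (n + m - 1))"
      if "v \<in> carrier (?F m)" for v
      using a that by (intro bilinear_ext_linear_left X.fin X.closed) auto
    have br: "?b n m i u \<in> linear_maps R (?F m) (?F (n + m - 1))" if "u \<in> carrier (?F n)" for u
      using a that by (intro bilinear_ext_linear_right X.fin X.closed) auto
    have cl: "(\<lambda>u. ?c n m i u v) \<in> linear_maps R (?G n) (?G (n + m - 1))"
      if "v \<in> carrier (?G m)" for v
      using a that by (intro bilinear_ext_linear_left Y.fin Y.closed) auto
    have cr: "?c n m i u \<in> linear_maps R (?G m) (?G (n + m - 1))" if "u \<in> carrier (?G n)" for u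
      using a that by (intro bilinear_ext_linear_right Y.fin Y.closed) auto
    have bb: "?b n m i (basis_vec R x) (basis_vec R y) = basis_vec R (B n m i x y)"
      if "x \<in> X n" "y \<in> X m" for x y
      using a that by (intro bilinear_ext_basis X.fin X.closed) auto
    have cb: "?c n m i (basis_vec R x) (basis_vec R y) = basis_vec R (C n m i x y)"
      if "x \<in> Y n" "y \<in> Y m" for x y
      using a that by (intro bilinear_ext_basis Y.fin Y.closed) auto
    have basis: "?f (n + m - 1) (?b n m i (basis_vec R x) (basis_vec R y)) =
        ?c n m i (?f n (basis_vec R x)) (?f m (basis_vec R y))"
      if "x \<in> X n" "y \<in> X m" for x y
      using a n that by (simp only: f_basis bb cb in_Y X.closed hom)
    show ?thesis
    proof (rule bilinear_eqI[where f = "\<lambda>u v. ?f (n + m - 1) (?b n m i u v)"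
          and g = "\<lambda>u v. ?c n m i (?f n u) (?f m v)", OF X.fin[OF n(1)] X.fin[OF a(3)]
          free_module_is_module _ _ _ _ basis u v])
      fix v assume v: "v \<in> carrier (?F m)"
      show "(\<lambda>u. ?f (n + m - 1) (?b n m i u v)) \<in> linear_maps R (?F n) (?G (n + m - 1))"
        by (rule linear_maps_comp[OF bl[OF v] f[OF n(2)]])
      show "(\<lambda>u. ?c n m i (?f n u) (?f m v)) \<in> linear_maps R (?F n) (?G (n + m - 1))"
        by (rule linear_maps_comp[OF f[OF n(1)] cl[OF linear_maps_closed[OF f[OF a(3)] v]]])
    next
      fix u assume u: "u \<in> carrier (?F n)"
      show "(\<lambda>v. ?f (n + m - 1) (?b n m i u v)) \<in> linear_maps R (?F m) (?G (n + m - 1))"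
        by (rule linear_maps_comp[OF br[OF u] f[OF n(2)]])
      show "(\<lambda>v. ?c n m i (?f n u) (?f m v)) \<in> linear_maps R (?F m) (?G (n + m - 1))"
        by (rule linear_maps_comp[OF f[OF a(3)] cr[OF linear_maps_closed[OF f[OF n(1)] u]]])
    qed
  qed
  have onto: "?f n ` carrier (?F n) = carrier (?G n)" if n: "n \<ge> 1" for n
  proof
    show "?f n ` carrier (?F n) \<subseteq> carrier (?G n)"
      using linear_maps_closed[OF f[OF n]] by blast
    \<comment> \<open>A set-theoretic section of \<open>\<phi> n\<close> extends linearly to a section of its extension.\<close>
    define g where "g = inv_into (X n) (\<phi> n)"
    have g: "g y \<in> X n" "\<phi> n (g y) = y" if "y \<in> Y n" for y
      using that surj[OF n] unfolding g_def by (simp_all add: inv_into_into f_inv_into_f)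
    have gl: "linear_ext R (Y n) (X n) g \<in> linear_maps R (?G n) (?F n)"
      using n g Y.fin by (intro linear_ext_linear) auto
    have id_lin: "(\<lambda>x. x) \<in> linear_maps R (?G n) (?G n)"
      by (simp add: linear_maps_def)
    have sect: "?f n (linear_ext R (Y n) (X n) g v) = v" if v: "v \<in> carrier (?G n)" for v
    proof (rule linear_maps_eqI[OF _ free_module_is_module _ id_lin _ v])
      show "(\<lambda>v. ?f n (linear_ext R (Y n) (X n) g v)) \<in> linear_maps R (?G n) (?G n)"
        by (rule linear_maps_comp[OF gl f[OF n]])
      show "?f n (linear_ext R (Y n) (X n) g (basis_vec R y)) = basis_vec R y" if "y \<in> Y n" for y
        using n that g Y.fin by (simp add: linear_ext_basis f_basis)
    qed (use n Y.fin in auto)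
    show "carrier (?G n) \<subseteq> ?f n ` carrier (?F n)"
    proof (intro subsetI)
      fix v assume v: "v \<in> carrier (?G n)"
      show "v \<in> ?f n ` carrier (?F n)"
        using sect[OF v] linear_maps_closed[OF gl v] by (metis image_eqI)
    qed
  qed
  have f_unit: "?f 1 (basis_vec R e) = basis_vec R e'"
    using f_basis[OF _ X.unit_closed] unit by simp
  show ?thesis
    unfolding basis_operad_def
  proof (intro surjective_ns_operad_morphism.intro surjective_ns_operad_morphism_axioms.intro
      ns_operad_morphism.intro ns_operad_morphism_axioms.intro, unfold operad.simps)
    show "ns_operad R \<lparr>cmp = ?F, circ = ?b, ident = basis_vec R e\<rparr>"
      using X.ns_operad_basis_operad[OF \<open>cring R\<close>] unfolding basis_operad_def .
    show "ns_operad R \<lparr>cmp = ?G, circ = ?c, ident = basis_vec R e'\<rparr>"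
      using Y.ns_operad_basis_operad[OF \<open>cring R\<close>] unfolding basis_operad_def .
  qed (fact f f_circ f_unit onto)+
qed

lemma (in cring) linear_ext_comp:
  assumes "finite X" and "finite Y" and "\<And>x. x \<in> X \<Longrightarrow> \<phi> x \<in> Y" and "\<And>y. y \<in> Y \<Longrightarrow> \<psi> y \<in> Z"
    and eq: "\<And>x. x \<in> X \<Longrightarrow> \<psi> (\<phi> x) = \<chi> x"
    and u: "u \<in> carrier (free_module R X)"
  shows "linear_ext R Y Z \<psi> (linear_ext R X Y \<phi> u) = linear_ext R X Z \<chi> u"
proof (rule linear_maps_eqI[OF assms(1) free_module_is_module _ _ _ u])
  show "(\<lambda>u. linear_ext R Y Z \<psi> (linear_ext R X Y \<phi> u))
      \<in> linear_maps R (free_module R X) (free_module R Z)"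
    by (rule linear_maps_comp[OF linear_ext_linear linear_ext_linear]) (fact assms)+
  show "linear_ext R X Z \<chi> \<in> linear_maps R (free_module R X) (free_module R Z)"
    using assms by (intro linear_ext_linear) (simp_all flip: eq)
  show "linear_ext R Y Z \<psi> (linear_ext R X Y \<phi> (basis_vec R x)) = linear_ext R X Z \<chi> (basis_vec R x)"
    if "x \<in> X" for x
  proof -
    have "\<chi> x \<in> Z" if "x \<in> X" for x
      using assms(3,4) that by (simp flip: eq)
    then show ?thesis
      using assms that by (simp add: linear_ext_basis)
  qed
qed


section \<open>Standardization\<close>

lemma perms_iff: "\<sigma> \<in> perms n \<longleftrightarrow> distinct \<sigma> \<and> set \<sigma> = {1..n}"
  by (auto simp: perms_def permutations_of_set_def)

lemma length_perms: "\<sigma> \<in> perms n \<Longrightarrow> length \<sigma> = n"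
  by (metis perms_iff card_atLeastAtMost diff_Suc_1 distinct_card)

lemma permsI:
  assumes "distinct \<sigma>" and "set \<sigma> \<subseteq> {1..n}" and "length \<sigma> = n"
  shows "\<sigma> \<in> perms n"
  using assms card_subset_eq[of "{1..n}" "set \<sigma>"] by (simp add: perms_iff distinct_card)

text \<open>Standardization applies to each letter the strictly increasing function \<open>rank\<close> of the set of
  letters. Hence it depends only on the relative order of the letters, and whatever is
  invariant under strictly increasing relabelling may be computed on the unstandardized word.\<close>

definition rank :: "nat set \<Rightarrow> nat \<Rightarrow> nat" where
  "rank X x = card {y \<in> X. y \<le> x}"

lemma st_eq_map_rank: "st xs = map (rank (set xs)) xs"
  by (simp add: st_def rank_def)

lemma strict_mono_on_rank:
  assumes "finite X"
  shows "strict_mono_on X (rank X)"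
proof (rule strict_mono_onI)
  fix x y assume "x \<in> X" "y \<in> X" "x < y"
  then have "{z \<in> X. z \<le> x} \<subset> {z \<in> X. z \<le> y}"
    by (force simp: psubset_eq)
  then show "rank X x < rank X y"
    unfolding rank_def using assms by (intro psubset_card_mono) auto
qed

lemma st_map_strict_mono:
  assumes "strict_mono_on (set xs) f"
  shows "st (map f xs) = st xs"
proof -
  have "card {y \<in> f ` set xs. y \<le> f x} = card {y \<in> set xs. y \<le> x}" if "x \<in> set xs" for x
  proof -
    have "{y \<in> f ` set xs. y \<le> f x} = f ` {y \<in> set xs. y \<le> x}"
      using that strict_mono_on_less_eq[OF assms] by auto
    moreover have "inj_on f {y \<in> set xs. y \<le> x}"
      using strict_mono_on_imp_inj_on[OF assms] by (rule inj_on_subset) auto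
    ultimately show ?thesis by (simp add: card_image)
  qed
  then show ?thesis by (simp add: st_def)
qed

lemma st_perms:
  assumes "\<sigma> \<in> perms n"
  shows "st \<sigma> = \<sigma>"
proof -
  have "{y \<in> {1..n}. y \<le> x} = {1..x}" if "x \<in> {1..n}" for x
    using that by auto
  then show ?thesis
    using assms by (auto simp: st_def perms_iff intro!: map_idI)
qed

lemma st_in_perms:
  assumes "distinct xs"
  shows "st xs \<in> perms (length xs)"
proof (rule permsI)
  have "inj_on (rank (set xs)) (set xs)"
    by (rule strict_mono_on_imp_inj_on[OF strict_mono_on_rank]) simp
  then show "distinct (st xs)"
    using assms by (simp add: st_eq_map_rank distinct_map)
  have "1 \<le> rank (set xs) x" if "x \<in> set xs" for x
  proof -
    have "{x} \<subseteq> {y \<in> set xs. y \<le> x}" using that by auto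
    then show ?thesis unfolding rank_def using card_mono[of "{y \<in> set xs. y \<le> x}" "{x}"] by simp
  qed
  moreover have "rank (set xs) x \<le> length xs" for x
    unfolding rank_def using card_mono[of "set xs" "{y \<in> set xs. y \<le> x}"] card_length[of xs] by simp
  ultimately show "set (st xs) \<subseteq> {1..length xs}"
    by (auto simp: st_eq_map_rank)
qed simp


section \<open>Decreasing trees\<close>

text \<open>The map \<open>perm_tree\<close> extended to words with distinct letters. On such words the recursion needs no
  standardization of the subwords (\<open>dec_tree_split\<close>), and subwords and relabelled words can be treated
  directly.\<close>

definition dec_tree :: "nat list \<Rightarrow> unit tree" where
  "dec_tree xs = perm_tree (st xs)"

lemma dec_tree_perms: "\<sigma> \<in> perms n \<Longrightarrow> dec_tree \<sigma> = perm_tree \<sigma>"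
  by (simp add: dec_tree_def st_perms)

lemma dec_tree_map: "strict_mono_on (set xs) f \<Longrightarrow> dec_tree (map f xs) = dec_tree xs"
  by (simp add: dec_tree_def st_map_strict_mono)

lemma dec_tree_Nil [simp]: "dec_tree [] = Leaf"
  by (simp add: dec_tree_def st_def perm_tree.simps)

lemma dec_tree_split:
  assumes "distinct (l @ M # r)" and less: "\<And>x. x \<in> set l \<union> set r \<Longrightarrow> x < M"
  shows "dec_tree (l @ M # r) = dec_tree l \<or>\<^sub>t dec_tree r"
proof -
  let ?xs = "l @ M # r"
  let ?rk = "rank (set ?xs)"
  have mono: "strict_mono_on (set ?xs) ?rk"
    by (rule strict_mono_on_rank) simp
  have "{y \<in> set ?xs. y \<le> M} = set ?xs"
    using less by (auto intro: less_imp_le)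
  then have M: "?rk M = length ?xs"
    unfolding rank_def using assms(1) by (metis distinct_card)
  have ne: "?rk x \<noteq> length ?xs" if "x \<in> set l \<union> set r" for x
    using strict_mono_onD[OF mono, of x M] less[OF that] that M by auto
  define N where "N = length ?xs"
  have st: "st ?xs = map ?rk l @ N # map ?rk r"
    using M by (simp add: st_eq_map_rank N_def)
  have len: "length (st ?xs) = N"
    by (simp add: N_def)
  have l: "\<forall>x\<in>set (map ?rk l). x \<noteq> N"
    using ne by (auto simp: N_def)
  have tw: "takeWhile (\<lambda>x. x \<noteq> N) (st ?xs) = map ?rk l"
    unfolding st using l by (subst takeWhile_append2) auto
  have dw: "dropWhile (\<lambda>x. x \<noteq> N) (st ?xs) = N # map ?rk r"
    unfolding st using l by (subst dropWhile_append2) auto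
  have "dec_tree ?xs = perm_tree (st (map ?rk l)) \<or>\<^sub>t perm_tree (st (map ?rk r))"
    unfolding dec_tree_def perm_tree.simps[of "st ?xs"] len tw dw by (simp add: st)
  moreover have "st (map ?rk l) = st l" "st (map ?rk r) = st r"
    using mono by (auto intro!: st_map_strict_mono elim: monotone_on_subset)
  ultimately show ?thesis by (simp add: dec_tree_def)
qed

lemma max_split:
  assumes "distinct xs" and "xs \<noteq> []"
  obtains l M r where "xs = l @ M # r" and "\<And>x. x \<in> set l \<union> set r \<Longrightarrow> x < (M :: nat)"
proof -
  have "Max (set xs) \<in> set xs"
    using assms(2) by simp
  then obtain l r where xs: "xs = l @ Max (set xs) # r"
    by (metis split_list)
  show thesis
  proof (rule that[OF xs])
    fix x assume x: "x \<in> set l \<union> set r"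
    then have "x \<in> set xs" using arg_cong[OF xs, of set] by auto
    then have "x \<le> Max (set xs)" by simp
    moreover have "x \<noteq> Max (set xs)"
      using x assms(1) arg_cong[OF xs, of distinct] by auto
    ultimately show "x < Max (set xs)" by simp
  qed
qed

text \<open>Induction along the recursion of decreasing trees.\<close>

lemma distinct_max_induct [consumes 1, case_names Nil max]:
  assumes "distinct xs"
    and "P []"
    and step: "\<And>l M r. distinct (l @ M # r) \<Longrightarrow> (\<And>x. x \<in> set l \<union> set r \<Longrightarrow> x < M) \<Longrightarrow> P l \<Longrightarrow> P r \<Longrightarrow>
      P (l @ (M :: nat) # r)"
  shows "P xs"
  using assms(1)
proof (induction xs rule: length_induct)
  case (1 xs)
  show ?case
  proof (cases "xs = []")
    case False
    with 1 obtain l M r where *: "xs = l @ M # r" "\<And>x. x \<in> set l \<union> set r \<Longrightarrow> x < M"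
      by (metis max_split)
    then have "P l" "P r" using 1 by auto
    then show ?thesis using step[of l M r] * 1 by auto
  qed (use assms(2) in simp)
qed

lemma size_dec_tree: "distinct xs \<Longrightarrow> size (dec_tree xs) = length xs"
  by (induction xs rule: distinct_max_induct) (simp, subst dec_tree_split, auto)

text \<open>All letters of \<open>xs\<close> being smaller, the root of the tree of \<open>xs @ ys\<close> is that of \<open>ys\<close>, and \<open>xs\<close> is passed
  on to the left subtree until \<open>ys\<close> is exhausted. The next lemma is the mirror image.\<close>

lemma dec_tree_over:
  assumes "distinct (xs @ ys)" and "\<And>x y. x \<in> set xs \<Longrightarrow> y \<in> set ys \<Longrightarrow> x < y"
  shows "dec_tree (xs @ ys) = over (dec_tree xs) (dec_tree ys)"
proof -
  have "distinct ys" using assms(1) by simp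
  then show ?thesis
    using assms
  proof (induction ys rule: distinct_max_induct)
    case (max l M r)
    have "dec_tree ((xs @ l) @ M # r) = dec_tree (xs @ l) \<or>\<^sub>t dec_tree r"
      using max.prems max.hyps by (intro dec_tree_split) auto
    then show ?case
      using max dec_tree_split[OF max.hyps] by auto
  qed simp
qed

lemma dec_tree_under:
  assumes "distinct (xs @ ys)" and "\<And>x y. x \<in> set xs \<Longrightarrow> y \<in> set ys \<Longrightarrow> y < x"
  shows "dec_tree (xs @ ys) = under (dec_tree xs) (dec_tree ys)"
proof -
  have "distinct xs" using assms(1) by simp
  then show ?thesis
    using assms
  proof (induction xs rule: distinct_max_induct)
    case (max l M r)
    have "dec_tree (l @ M # (r @ ys)) = dec_tree l \<or>\<^sub>t dec_tree (r @ ys)"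
      using max.prems max.hyps by (intro dec_tree_split) auto
    then show ?case
      using max dec_tree_split[OF max.hyps] by auto
  qed simp
qed

text \<open>Inflating a letter \<open>v\<close> to a block \<open>ts\<close> that compares with the other letters as \<open>v\<close> does. The induction
  follows the position of the largest letter \<open>M\<close> of \<open>p @ v # q\<close>: right of \<open>v\<close>, left of \<open>v\<close>, or \<open>v\<close> itself;
  these are the three branches of \<open>tree_comp\<close>.\<close>

lemma dec_tree_insert:
  assumes "distinct (p @ v # q)" and "distinct (p @ ts @ q)" and "ts \<noteq> []"
    and "\<And>x t. x \<in> set p \<union> set q \<Longrightarrow> t \<in> set ts \<Longrightarrow> x < t \<longleftrightarrow> x < v"
  shows "dec_tree (p @ ts @ q) = tree_comp (Suc (length p)) (dec_tree (p @ v # q)) (dec_tree ts)"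
proof -
  define xs where "xs = p @ v # q"
  have "distinct xs" using assms(1) by (simp add: xs_def)
  then show ?thesis
    using xs_def assms
  proof (induction xs arbitrary: p q rule: distinct_max_induct)
    case Nil
    then show ?case by simp
  next
    case (max l M r)
    note eq = max.prems(1) and d = max.prems(2,3) and ts = max.prems(4) and cmp = max.prems(5)
    have root: "dec_tree (p @ v # q) = dec_tree l \<or>\<^sub>t dec_tree r"
      using dec_tree_split[OF max.hyps] eq by simp
    have size_l: "size (dec_tree l) = length l"
      using max.hyps(1) by (simp add: size_dec_tree)
    consider us where "l = p @ v # us" "q = us @ M # r" | us where "p = l @ M # us" "r = us @ v # q"
      | "l = p" "M = v" "r = q"
      using eq unfolding append_eq_append_conv2 by (auto simp: Cons_eq_append_conv append_eq_Cons_conv)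
    then show ?case
    proof cases
      case 1
      have big: "t < M" if "t \<in> set ts" for t
        using cmp[of M t] that max.hyps(2)[of v] 1 d(2) by (auto simp: not_less_iff_gr_or_eq)
      have "dec_tree (p @ ts @ us) = tree_comp (Suc (length p)) (dec_tree l) (dec_tree ts)"
        using max.IH(1)[OF 1(1)] d ts cmp 1 by auto
      moreover have "dec_tree ((p @ ts @ us) @ M # r) = dec_tree (p @ ts @ us) \<or>\<^sub>t dec_tree r"
        using d big max.hyps(2) 1 by (intro dec_tree_split) auto
      ultimately show ?thesis
        using size_l unfolding root by (simp add: 1)
    next
      case 2
      have big: "t < M" if "t \<in> set ts" for t
        using cmp[of M t] that max.hyps(2)[of v] 2 d(2) by (auto simp: not_less_iff_gr_or_eq)
      have "dec_tree (us @ ts @ q) = tree_comp (Suc (length us)) (dec_tree r) (dec_tree ts)"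
        using max.IH(2)[OF 2(2)] d ts cmp 2 by auto
      moreover have "dec_tree (l @ M # (us @ ts @ q)) = dec_tree l \<or>\<^sub>t dec_tree (us @ ts @ q)"
        using d big max.hyps(2) 2 by (intro dec_tree_split) auto
      ultimately show ?thesis
        using size_l unfolding root by (simp add: 2)
    next
      case 3
      have small: "x < t" if "x \<in> set p \<union> set q" "t \<in> set ts" for x t
        using cmp[OF that] max.hyps(2)[of x] that 3 by auto
      have "distinct ts" using d by simp
      then obtain a N b where ab: "ts = a @ N # b" "\<And>x. x \<in> set a \<union> set b \<Longrightarrow> x < N"
        using ts by (metis max_split)
      have "dec_tree ts = dec_tree a \<or>\<^sub>t dec_tree b"
        using ab d by (auto intro!: dec_tree_split)
      moreover have "dec_tree ((p @ a) @ N # (b @ q)) = dec_tree (p @ a) \<or>\<^sub>t dec_tree (b @ q)"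
        using d ab small by (intro dec_tree_split) auto
      moreover have "dec_tree (p @ a) = over (dec_tree p) (dec_tree a)"
        using d ab small by (intro dec_tree_over) auto
      moreover have "dec_tree (b @ q) = under (dec_tree b) (dec_tree q)"
        using d ab small by (intro dec_tree_under) auto
      ultimately show ?thesis
        using size_l unfolding root by (simp add: ab 3)
    qed
  qed
qed

text \<open>The words of the two subtrees are made disjoint by shifting the right one, and a letter larger
  than both is put between them.\<close>

lemma dec_tree_surj:
  obtains xs where "distinct xs" and "length xs = size t" and "dec_tree xs = t"
proof (induction t arbitrary: thesis)
  case Leaf
  show ?case by (rule Leaf[of "[]"]) simp_all
next
  case (Node l u r)
  obtain xs where xs: "distinct xs" "length xs = size l" "dec_tree xs = l"
    using Node.IH(1) .
  obtain ys where ys: "distinct ys" "length ys = size r" "dec_tree ys = r"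
    using Node.IH(2) .
  define N where "N = Suc (sum_list xs)"
  define zs where "zs = map (\<lambda>y. N + y) ys"
  define M where "M = Suc (N + sum_list zs)"
  have x: "x < N" if "x \<in> set xs" for x
    using member_le_sum_list[OF that] by (simp add: N_def)
  have z: "N \<le> z \<and> z < M" if "z \<in> set zs" for z
    using member_le_sum_list[OF that] that by (auto simp: M_def zs_def)
  have zs: "distinct zs" "length zs = size r" "dec_tree zs = r"
    unfolding zs_def using ys
    by (auto simp: distinct_map inj_on_def strict_mono_on_def intro!: trans[OF dec_tree_map])
  have "N < M" by (simp add: M_def)
  have "distinct (xs @ M # zs)"
    using xs zs x z \<open>N < M\<close> by fastforce
  moreover from this have "dec_tree (xs @ M # zs) = l \<or>\<^sub>t r"
    using dec_tree_split[of xs M zs] x z \<open>N < M\<close> xs zs by fastforce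
  ultimately show ?case
    using xs zs by (intro Node.prems[of "xs @ M # zs"]) auto
qed


section \<open>Descents\<close>

text \<open>The descent set as a word with one letter for each pair of neighbours. Unlike the set, it
  is compatible with concatenation without any shift of indices.\<close>

fun descents :: "nat list \<Rightarrow> bool list" where
  "descents (x # y # xs) = (y < x) # descents (y # xs)"
| "descents _ = []"

lemma length_descents [simp]: "length (descents xs) = length xs - 1"
  by (induction xs rule: descents.induct) auto

lemma nth_descents: "Suc k < length xs \<Longrightarrow> descents xs ! k \<longleftrightarrow> xs ! Suc k < xs ! k"
  by (induction xs arbitrary: k rule: descents.induct) (auto simp: nth_Cons split: nat.splits)

lemma Des_eq_descents: "Des xs = {p \<in> {1..length xs - 1}. descents xs ! (p - 1)}"
  by (auto simp: Des_def nth_descents)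

lemma descents_map:
  assumes "strict_mono_on (set xs) f"
  shows "descents (map f xs) = descents xs"
  using assms
proof (induction xs rule: descents.induct)
  case (1 x y xs)
  have "strict_mono_on (set (y # xs)) f"
    using 1(2) by (rule monotone_on_subset) auto
  then show ?case
    using 1 by (simp add: strict_mono_on_less[OF 1(2)])
qed simp_all

text \<open>A maximal letter is preceded by an ascent.\<close>

lemma descents_append_max:
  assumes "\<And>x. x \<in> set l \<Longrightarrow> x < M"
  shows "descents (l @ M # r) = (if l = [] then [] else descents l @ [False]) @ descents (M # r)"
  using assms by (induction l rule: descents.induct) (auto simp: not_less less_imp_le)

text \<open>Of the leaves of a nonempty tree, the first points left and the last points right; the ones in
  between spell the descent word. In the induction step, the last leaf of the left subtree sits
  before the largest letter \<open>M\<close> and accounts for the ascent to \<open>M\<close>, and the first leaf of the right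
  subtree accounts for the descent from \<open>M\<close>. An empty subtree is an outermost leaf of the whole tree.\<close>

lemma leaf_dirs_dec_tree:
  assumes "distinct xs"
  shows "leaf_dirs d (dec_tree xs) = (if xs = [] then [d] else True # descents xs @ [False])"
  using assms
proof (induction xs arbitrary: d rule: distinct_max_induct)
  case (max l M r)
  have "descents (M # r) = (if r = [] then [] else True # descents r)"
    using max.hyps(2) by (cases r) auto
  moreover have "descents (l @ M # r) =
      (if l = [] then [] else descents l @ [False]) @ descents (M # r)"
    using max.hyps(2) by (intro descents_append_max) auto
  ultimately show ?case
    using dec_tree_split[OF max.hyps] max.IH by simp
qed simp

lemma left_leaves_perm_tree:
  assumes "\<sigma> \<in> perms n"
  shows "left_leaves (perm_tree \<sigma>) = Des \<sigma>"
proof -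
  have d: "distinct \<sigma>" using assms by (simp add: perms_iff)
  have "leaf_dirs True (perm_tree \<sigma>) ! p = descents \<sigma> ! (p - 1)" if "p \<in> {1..length \<sigma> - 1}" for p
    using that d leaf_dirs_dec_tree[OF d, of True] dec_tree_perms[OF assms]
    by (auto simp: nth_Cons nth_append split: nat.splits)
  moreover have "size (perm_tree \<sigma>) = length \<sigma>"
    using size_dec_tree[OF d] dec_tree_perms[OF assms] by simp
  ultimately show ?thesis
    by (auto simp: left_leaves_def Des_eq_descents)
qed

text \<open>A word is extended on the left by a letter above all others to start with a descent, and by a
  letter below all others to start with an ascent.\<close>

lemma descents_surj:
  obtains xs where "distinct xs" and "length xs = Suc (length w)" and "descents xs = w"
proof (induction w arbitrary: thesis)
  case Nil
  show ?case by (rule Nil[of "[0]"]) simp_all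
next
  case (Cons b w)
  obtain xs where xs: "distinct xs" "length xs = Suc (length w)" "descents xs = w"
    using Cons.IH .
  then obtain y ys where y: "xs = y # ys" by (cases xs) auto
  show ?case
  proof (cases b)
    case True
    have less: "x < Suc (sum_list xs)" if "x \<in> set xs" for x
      using member_le_sum_list[OF that] by simp
    show ?thesis
      using xs True less by (intro Cons.prems[of "Suc (sum_list xs) # xs"]) (auto simp: y)
  next
    case False
    have "descents (map Suc xs) = w"
      using xs descents_map[of xs Suc] by (simp add: strict_mono_on_def)
    then show ?thesis
      using xs False by (intro Cons.prems[of "0 # map Suc xs"]) (auto simp: y distinct_map)
  qed
qed


section \<open>The operad structure on permutations\<close>

text \<open>The relabelling of the other letters when \<open>v\<close> is replaced by the \<open>m\<close> values from \<open>v\<close> to \<open>v + m - 1\<close>.\<close>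

definition make_room :: "nat \<Rightarrow> nat \<Rightarrow> nat \<Rightarrow> nat" where
  "make_room v m s = (if s < v then s else s + m - 1)"

lemma perm_comp_append:
  assumes "i = Suc (length p)"
  shows "perm_comp i (p @ v # q) \<tau> =
    map (make_room v (length \<tau>)) p @ map (\<lambda>t. t + v - 1) \<tau> @ map (make_room v (length \<tau>)) q"
  using assms by (simp add: perm_comp_def Let_def make_room_def[abs_def] nth_append)

lemma perms_split:
  assumes "\<sigma> \<in> perms n" and "1 \<le> i" and "i \<le> n"
  obtains p v q where "\<sigma> = p @ v # q" and "i = Suc (length p)"
proof -
  have "i - 1 < length \<sigma>" using assms by (simp add: length_perms)
  then show thesis
    using assms(2) id_take_nth_drop[of "i - 1" \<sigma>] by (intro that[of "take (i - 1) \<sigma>"]) auto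
qed

lemma perms_elem: "\<sigma> \<in> perms n \<Longrightarrow> x \<in> set \<sigma> \<Longrightarrow> 1 \<le> x \<and> x \<le> n"
  by (auto simp: perms_iff)

text \<open>By counting, it is enough that the letters are distinct and lie in the right range. A relabelled
  letter cannot meet the block because \<open>make_room\<close> leaves out exactly the values of the block.\<close>

lemma perm_comp_closed:
  assumes i: "1 \<le> i" "i \<le> n" and "m \<ge> 1" and \<sigma>: "\<sigma> \<in> perms n" and \<tau>: "\<tau> \<in> perms m"
  shows "perm_comp i \<sigma> \<tau> \<in> perms (n + m - 1)"
proof -
  obtain p v q where s: "\<sigma> = p @ v # q" "i = Suc (length p)"
    using perms_split[OF \<sigma> i] .
  have len: "length \<tau> = m" "length \<sigma> = n"
    using \<sigma> \<tau> by (auto simp: length_perms)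
  have d: "distinct (p @ v # q)" "distinct \<tau>"
    using \<sigma> \<tau> s by (auto simp: perms_iff)
  have bs: "1 \<le> x \<and> x \<le> n" if "x \<in> set p \<union> set q \<union> {v}" for x
    using perms_elem[OF \<sigma>, of x] that s by auto
  have bt: "1 \<le> x \<and> x \<le> m" if "x \<in> set \<tau>" for x
    using perms_elem[OF \<tau> that] .
  have inj: "inj_on (make_room v m) (set p \<union> set q)"
    using d(1) \<open>m \<ge> 1\<close> by (auto simp: inj_on_def make_room_def split: if_splits)
  have apart: "make_room v m x \<noteq> t + v - 1" if "x \<in> set p \<union> set q" "t \<in> set \<tau>" for x t
  proof -
    have "x \<noteq> v" using that(1) d(1) by auto
    then show ?thesis
      using bt[OF that(2)] bs[of v] by (auto simp: make_room_def)
  qed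
  show ?thesis
    unfolding s(1) perm_comp_append[OF s(2)] len(1)
  proof (rule permsI)
    have "inj_on (\<lambda>t. t + v - 1) (set \<tau>)"
      using bs[of v] by (auto simp: inj_on_def)
    moreover have "make_room v m ` set p \<inter> make_room v m ` set q = {}"
      using inj_on_image_Int[OF inj, of "set p" "set q"] d(1) by auto
    ultimately show "distinct (map (make_room v m) p @ map (\<lambda>t. t + v - 1) \<tau> @ map (make_room v m) q)"
      using d inj apart by (fastforce simp: distinct_map inj_on_Un)
    have "make_room v m x \<in> {1..n + m - 1}" if "x \<in> set p \<union> set q" for x
      using bs[of x] that \<open>m \<ge> 1\<close> by (auto simp: make_room_def)
    moreover have "t + v - 1 \<in> {1..n + m - 1}" if "t \<in> set \<tau>" for t
      using bt[OF that] bs[of v] by auto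
    ultimately show "set (map (make_room v m) p @ map (\<lambda>t. t + v - 1) \<tau> @ map (make_room v m) q)
        \<subseteq> {1..n + m - 1}"
      by auto
  qed (use len s \<open>m \<ge> 1\<close> in auto)
qed

text \<open>Both sides inflate the two letters \<open>v\<close> and \<open>w\<close> of a word \<open>p' @ v # q @ w # r\<close>. Written out as
  concatenations they agree segment by segment, by linear arithmetic with the values of the letters.\<close>

lemma perm_comp_parallel:
  assumes a: "1 \<le> i" "i < j" "j \<le> n" "m \<ge> 1" "l \<ge> 1"
    and x: "x \<in> perms n" and y: "y \<in> perms m" and z: "z \<in> perms l"
  shows "perm_comp (j + m - 1) (perm_comp i x y) z = perm_comp i (perm_comp j x z) y"
proof -
  obtain p w r where 1: "x = p @ w # r" "j = Suc (length p)"
    using perms_split[OF x, of j] a by auto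
  have "i - 1 < length p"
    using a 1 by simp
  from id_take_nth_drop[OF this] obtain p' v q where 2: "p = p' @ v # q" "i = Suc (length p')"
    using a by (metis Suc_diff_1 \<open>i - 1 < length p\<close> length_take less_eq_Suc_le min.absorb4 One_nat_def)
  have xs: "x = p' @ v # q @ w # r" "x = (p' @ v # q) @ w # r"
    using 1 2 by auto
  have len: "length y = m" "length z = l"
    using y z by (auto simp: length_perms)
  have d: "distinct (p' @ v # q @ w # r)"
    using x xs by (simp add: perms_iff)
  have b: "1 \<le> v" "1 \<le> w"
    using perms_elem[OF x] xs by auto
  have ty: "1 \<le> t \<and> t \<le> m" if "t \<in> set y" for t
    using perms_elem[OF y that] .
  have tz: "1 \<le> t \<and> t \<le> l" if "t \<in> set z" for t
    using perms_elem[OF z that] .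
  have j: "j + m - 1 = Suc (length (map (make_room v m) p' @ map (\<lambda>t. t + v - 1) y @ map (make_room v m) q))"
    using 1 2 len a by simp
  have j': "j = Suc (length (p' @ v # q))"
    using 1 2 by simp
  have i': "i = Suc (length (map (make_room w l) p'))"
    using 2 by simp
  have "perm_comp (j + m - 1) (perm_comp i x y) z =
      perm_comp (j + m - 1) ((map (make_room v m) p' @ map (\<lambda>t. t + v - 1) y @ map (make_room v m) q)
        @ make_room v m w # map (make_room v m) r) z"
    unfolding xs(1) perm_comp_append[OF 2(2)] len by simp
  also have "\<dots> = perm_comp i (map (make_room w l) p' @ make_room w l v #
      map (make_room w l) q @ map (\<lambda>t. t + w - 1) z @ map (make_room w l) r) y"
    unfolding perm_comp_append[OF j] perm_comp_append[OF i'] len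
    using d b a by (auto simp: make_room_def dest!: ty tz)
  also have "\<dots> = perm_comp i (perm_comp j x z) y"
    unfolding xs(2) perm_comp_append[OF j'] len by simp
  finally show ?thesis .
qed

lemma perm_comp_sequential:
  assumes a: "1 \<le> i" "i \<le> n" "1 \<le> j" "j \<le> m" "l \<ge> 1"
    and x: "x \<in> perms n" and y: "y \<in> perms m" and z: "z \<in> perms l"
  shows "perm_comp (i + j - 1) (perm_comp i x y) z = perm_comp i x (perm_comp j y z)"
proof -
  obtain p v q where 1: "x = p @ v # q" "i = Suc (length p)"
    using perms_split[OF x] a by metis
  obtain r w s where 2: "y = r @ w # s" "j = Suc (length r)"
    using perms_split[OF y] a by metis
  have len: "length y = m" "length z = l" "length (perm_comp j y z) = m + l - 1"
    using y z perm_comp_closed[OF a(3-5) y z] by (auto simp: length_perms)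
  have d: "distinct (p @ v # q)" "distinct (r @ w # s)"
    using x y 1 2 by (auto simp: perms_iff)
  have b: "1 \<le> v" "1 \<le> w" "w \<le> m"
    using perms_elem[OF x] perms_elem[OF y] 1 2 by auto
  have ty: "1 \<le> t \<and> t \<le> m" if "t \<in> set r \<union> set s" for t
    using perms_elem[OF y] that 2 by auto
  have tz: "1 \<le> t \<and> t \<le> l" if "t \<in> set z" for t
    using perms_elem[OF z that] .
  have ij: "i + j - 1 = Suc (length (map (make_room v m) p @ map (\<lambda>t. t + v - 1) r))"
    using 1 2 by simp
  have "perm_comp (i + j - 1) (perm_comp i x y) z =
      perm_comp (i + j - 1) ((map (make_room v m) p @ map (\<lambda>t. t + v - 1) r) @ (w + v - 1) #
        map (\<lambda>t. t + v - 1) s @ map (make_room v m) q) z"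
    unfolding 1(1) perm_comp_append[OF 1(2)] len by (simp add: 2(1))
  also have "\<dots> = map (make_room v (m + l - 1)) p @
      map (\<lambda>t. t + v - 1) (map (make_room w l) r @ map (\<lambda>t. t + w - 1) z @ map (make_room w l) s) @
      map (make_room v (m + l - 1)) q"
    unfolding perm_comp_append[OF ij] len
    using d b a by (auto simp: make_room_def dest!: ty tz)
  also have "\<dots> = perm_comp i x (perm_comp j y z)"
    unfolding 1(1) perm_comp_append[OF 1(2)] len unfolding 2(1) perm_comp_append[OF 2(2)] len ..
  finally show ?thesis .
qed

lemma perm_comp_unit_right:
  assumes "1 \<le> i" "i \<le> n" and x: "x \<in> perms n"
  shows "perm_comp i x [1] = x"
proof -
  obtain p v q where s: "x = p @ v # q" "i = Suc (length p)"
    using perms_split[OF x assms(1,2)] .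
  have "make_room v 1 = (\<lambda>s. s)"
    by (auto simp: make_room_def)
  then show ?thesis
    unfolding s(1) perm_comp_append[OF s(2)] by simp
qed

lemma perm_comp_unit_left: "perm_comp 1 [1] x = x"
  by (simp add: perm_comp_def)

lemma set_operad_perms: "set_operad perms (\<lambda>n m. perm_comp) [1]"
proof (unfold_locales, goal_cases)
  case (1 n)
  show ?case by (simp add: perms_def)
next
  case 3
  show ?case by (simp add: perms_iff)
qed (assumption | rule perm_comp_closed perm_comp_parallel perm_comp_sequential
    perm_comp_unit_right perm_comp_unit_left)+


section \<open>The quotient maps\<close>

text \<open>The composite is the word \<open>\<sigma>\<close>, relabelled by \<open>make_room v m\<close>, with the letter that \<open>v\<close> becomes
  inflated to a shifted copy of \<open>\<tau>\<close>. That letter is \<open>v + m - 1\<close>, the largest of the block, and compares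
  with the letters outside as the whole block does. Relabelling and shifting are strictly increasing
  and do not change the trees.\<close>

lemma perm_tree_perm_comp:
  assumes i: "1 \<le> i" "i \<le> n" and "m \<ge> 1" and \<sigma>: "\<sigma> \<in> perms n" and \<tau>: "\<tau> \<in> perms m"
  shows "perm_tree (perm_comp i \<sigma> \<tau>) = tree_comp i (perm_tree \<sigma>) (perm_tree \<tau>)"
proof -
  obtain p v q where s: "\<sigma> = p @ v # q" "i = Suc (length p)"
    using perms_split[OF \<sigma> i] .
  have len: "length \<tau> = m"
    using \<tau> by (simp add: length_perms)
  let ?a = "make_room v m" and ?b = "\<lambda>t. t + v - 1"
  have d: "distinct (p @ v # q)"
    using \<sigma> s by (simp add: perms_iff)
  have v: "1 \<le> v"
    using perms_elem[OF \<sigma>] s by auto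
  have bt: "1 \<le> t \<and> t \<le> m" if "t \<in> set \<tau>" for t
    using perms_elem[OF \<tau> that] .
  have comp: "perm_comp i \<sigma> \<tau> = map ?a p @ map ?b \<tau> @ map ?a q"
    unfolding s(1) perm_comp_append[OF s(2)] len ..
  have mono: "strict_mono_on (set (p @ v # q)) ?a"
    using \<open>m \<ge> 1\<close> by (intro strict_mono_onI) (auto simp: make_room_def)
  have rel: "map ?a p @ ?a v # map ?a q = map ?a (p @ v # q)"
    by simp
  have "perm_tree (perm_comp i \<sigma> \<tau>) = dec_tree (map ?a p @ map ?b \<tau> @ map ?a q)"
    using dec_tree_perms[OF perm_comp_closed[OF assms]] comp by simp
  also have "\<dots> = tree_comp (Suc (length (map ?a p))) (dec_tree (map ?a p @ ?a v # map ?a q)) (dec_tree (map ?b \<tau>))"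
  proof (rule dec_tree_insert)
    show "distinct (map ?a p @ ?a v # map ?a q)"
      unfolding rel distinct_map using d strict_mono_on_imp_inj_on[OF mono] by blast
    show "distinct (map ?a p @ map ?b \<tau> @ map ?a q)"
      using perm_comp_closed[OF assms] comp by (simp add: perms_iff)
    show "map ?b \<tau> \<noteq> []"
      using len \<open>m \<ge> 1\<close> by auto
    fix x t assume "x \<in> set (map ?a p) \<union> set (map ?a q)" "t \<in> set (map ?b \<tau>)"
    then show "x < t \<longleftrightarrow> x < ?a v"
      using d v by (auto simp: make_room_def dest!: bt)
  qed
  also have "dec_tree (map ?a p @ ?a v # map ?a q) = perm_tree \<sigma>"
    unfolding rel using dec_tree_map[OF mono] dec_tree_perms[OF \<sigma>] s by simp
  also have "dec_tree (map ?b \<tau>) = perm_tree \<tau>"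
  proof -
    have "strict_mono_on (set \<tau>) ?b"
      using v by (intro strict_mono_onI) auto
    then show ?thesis using dec_tree_map dec_tree_perms[OF \<tau>] by simp
  qed
  finally show ?thesis using s(2) by simp
qed

lemma perm_tree_image: "perm_tree ` perms n = trees n"
proof
  show "perm_tree ` perms n \<subseteq> trees n"
  proof
    fix t assume "t \<in> perm_tree ` perms n"
    then obtain \<sigma> where \<sigma>: "\<sigma> \<in> perms n" "t = perm_tree \<sigma>" by auto
    then show "t \<in> trees n"
      using size_dec_tree[of \<sigma>] dec_tree_perms[OF \<sigma>(1)] length_perms[OF \<sigma>(1)]
      by (simp add: trees_def perms_iff)
  qed
  show "trees n \<subseteq> perm_tree ` perms n"
  proof
    fix t assume t: "t \<in> trees n"
    obtain xs where xs: "distinct xs" "length xs = size t" "dec_tree xs = t"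
      using dec_tree_surj .
    then show "t \<in> perm_tree ` perms n"
      using st_in_perms[OF xs(1)] t by (auto simp: trees_def dec_tree_def)
  qed
qed

lemma Des_image: "Des ` perms n = subsets n" if "n \<ge> 1"
proof
  show "Des ` perms n \<subseteq> subsets n"
    by (auto simp: Des_def subsets_def length_perms)
  show "subsets n \<subseteq> Des ` perms n"
  proof
    fix S assume S: "S \<in> subsets n"
    define w where "w = map (\<lambda>p. p \<in> S) [1..<n]"
    obtain xs where xs: "distinct xs" "length xs = Suc (length w)" "descents xs = w"
      using descents_surj .
    have len: "length xs = n" using xs(2) that by (simp add: w_def)
    have "descents (st xs) = w"
      unfolding st_eq_map_rank using descents_map[OF strict_mono_on_rank] xs(3) by simp
    then have "Des (st xs) = {p \<in> {1..n - 1}. w ! (p - 1)}"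
      using len by (simp add: Des_eq_descents)
    also have "\<dots> = {p \<in> {1..n - 1}. p \<in> S}"
      by (intro Collect_cong conj_cong refl) (auto simp: w_def)
    also have "\<dots> = S"
      using S by (auto simp: subsets_def)
    finally show "S \<in> Des ` perms n"
      using st_in_perms[OF xs(1)] len by blast
  qed
qed

lemma make_room_less_iff:
  assumes "x \<noteq> v" and "y \<noteq> v"
  shows "make_room v m x < make_room v m y \<longleftrightarrow> x < y"
  using assms by (auto simp: make_room_def)

lemma make_room_block_less_iff:
  assumes "x \<noteq> v" and "1 \<le> t" and "t \<le> m"
  shows "make_room v m x < t + v - 1 \<longleftrightarrow> x < v" and "t + v - 1 < make_room v m x \<longleftrightarrow> v < x"
  using assms by (auto simp: make_room_def)

text \<open>The two shifts in \<open>subset_comp\<close>, solved for the element of \<open>T\<close> or \<open>S\<close>.\<close>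

lemma mem_subset_comp_iff:
  assumes "1 \<le> i" and "1 \<le> m" and "S \<subseteq> {1..n - 1}" and "T \<subseteq> {1..m - 1}"
  shows "c \<in> subset_comp n m i S T \<longleftrightarrow>
    (c \<in> S \<and> c < i) \<or> (i \<le> c \<and> c + 1 - i \<in> T) \<or> (i + m \<le> c + 1 \<and> c + 1 - m \<in> S)"
proof -
  have "c \<in> S \<inter> {1..i - 1} \<longleftrightarrow> c \<in> S \<and> c < i"
    using assms(1,3) by fastforce
  moreover have "c \<in> (\<lambda>t. t + i - 1) ` T \<longleftrightarrow> i \<le> c \<and> c + 1 - i \<in> T"
  proof
    assume "i \<le> c \<and> c + 1 - i \<in> T"
    then show "c \<in> (\<lambda>t. t + i - 1) ` T"
      by (intro image_eqI[of _ _ "c + 1 - i"]) auto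
  next
    assume "c \<in> (\<lambda>t. t + i - 1) ` T"
    then obtain t where t: "t \<in> T" "c = t + i - 1" by blast
    moreover from this have "1 \<le> t" using assms(4) by auto
    ultimately show "i \<le> c \<and> c + 1 - i \<in> T"
      using assms(1) by simp
  qed
  moreover have "c \<in> (\<lambda>s. s + m - 1) ` (S \<inter> {i..n - 1}) \<longleftrightarrow> i + m \<le> c + 1 \<and> c + 1 - m \<in> S"
  proof
    assume *: "i + m \<le> c + 1 \<and> c + 1 - m \<in> S"
    then have "c = c + 1 - m + m - 1" "i \<le> c + 1 - m" using assms(1,2) by auto
    moreover have "c + 1 - m \<le> n - 1" using * assms(3) by auto
    ultimately show "c \<in> (\<lambda>s. s + m - 1) ` (S \<inter> {i..n - 1})"
      using * by (intro image_eqI[of _ _ "c + 1 - m"]) auto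
  next
    assume "c \<in> (\<lambda>s. s + m - 1) ` (S \<inter> {i..n - 1})"
    then obtain t where t: "t \<in> S" "i \<le> t" "c = t + m - 1" by auto
    then show "i + m \<le> c + 1 \<and> c + 1 - m \<in> S"
      using assms(2) by simp
  qed
  ultimately show ?thesis
    unfolding subset_comp_def by blast
qed

lemma Des_subset: "\<sigma> \<in> perms n \<Longrightarrow> Des \<sigma> \<subseteq> {1..n - 1}"
  by (auto simp: Des_def length_perms)

text \<open>A position compares two neighbours before the block, inside it, or after it, or one letter outside
  the block with an end of the block. In the last case every letter of the block compares with the
  outer letter as \<open>v\<close> does, so the descent is one of \<open>\<sigma>\<close> at \<open>v\<close>.\<close>

lemma Des_perm_comp:
  assumes i: "1 \<le> i" "i \<le> n" and m: "m \<ge> 1" and \<sigma>: "\<sigma> \<in> perms n" and \<tau>: "\<tau> \<in> perms m"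
  shows "Des (perm_comp i \<sigma> \<tau>) = subset_comp n m i (Des \<sigma>) (Des \<tau>)"
proof -
  obtain p v q where s: "\<sigma> = p @ v # q" "i = Suc (length p)"
    using perms_split[OF \<sigma> i] .
  define \<pi> where "\<pi> = perm_comp i \<sigma> \<tau>"
  define b where "b = length p"
  let ?a = "make_room v m"
  have len: "length \<tau> = m" "length \<pi> = n + m - 1"
    using length_perms[OF \<tau>] length_perms[OF perm_comp_closed[OF assms]] by (auto simp: \<pi>_def)
  have n: "n = Suc (b + length q)"
    using length_perms[OF \<sigma>] s by (simp add: b_def)
  have \<pi>: "\<pi> = map ?a p @ map (\<lambda>t. t + v - 1) \<tau> @ map ?a q"
    unfolding \<pi>_def s(1) perm_comp_append[OF s(2)] len(1) ..
  have \<pi>_before: "\<pi> ! k = ?a (\<sigma> ! k)" if "k < b" for k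
    using that by (simp add: \<pi> s(1) b_def nth_append)
  have \<pi>_block: "\<pi> ! (b + k) = \<tau> ! k + v - 1" if "k < m" for k
    using that len by (simp add: \<pi> b_def nth_append)
  have \<pi>_after: "\<pi> ! (b + m + k) = ?a (\<sigma> ! (b + 1 + k))" if "b + 1 + k < n" for k
    using that len n by (simp add: \<pi> s(1) b_def nth_append)
  have v: "\<sigma> ! b = v"
    by (simp add: s(1) b_def)
  have ne: "\<sigma> ! k \<noteq> v" if "k < n" "k \<noteq> b" for k
  proof -
    have "\<sigma> ! k \<noteq> \<sigma> ! b"
      using that \<sigma> n length_perms[OF \<sigma>] by (simp add: perms_iff nth_eq_iff_index_eq)
    then show ?thesis by (simp add: v)
  qed
  have \<tau>_bounds: "1 \<le> \<tau> ! k" "\<tau> ! k \<le> m" if "k < m" for k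
    using perms_elem[OF \<tau>, of "\<tau> ! k"] that len by simp_all
  have v_pos: "1 \<le> v"
    using perms_elem[OF \<sigma>, of v] s by simp
  have D\<sigma>: "c \<in> Des \<sigma> \<longleftrightarrow> 1 \<le> c \<and> c < n \<and> \<sigma> ! c < \<sigma> ! (c - 1)" for c
    using length_perms[OF \<sigma>] n by (auto simp: Des_def)
  have D\<tau>: "c \<in> Des \<tau> \<longleftrightarrow> 1 \<le> c \<and> c < m \<and> \<tau> ! c < \<tau> ! (c - 1)" for c
    using len m by (auto simp: Des_def)
  have D\<pi>: "c \<in> Des \<pi> \<longleftrightarrow> 1 \<le> c \<and> c < b + length q + m \<and> \<pi> ! c < \<pi> ! (c - 1)" for c
    using len m n by (auto simp: Des_def)
  have b: "i = b + 1"
    using s(2) by (simp add: b_def)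
  note mem = mem_subset_comp_iff[OF i(1) m Des_subset[OF \<sigma>] Des_subset[OF \<tau>], unfolded b]
  have "c \<in> Des \<pi> \<longleftrightarrow> c \<in> subset_comp n m (b + 1) (Des \<sigma>) (Des \<tau>)" for c
  proof -
    \<comment> \<open>In \<open>\<pi>\<close>, counted from 0, the block occupies the positions \<open>b, \<dots>, b + m - 1\<close>, and \<open>c\<close> compares
      position \<open>c - 1\<close> with position \<open>c\<close>.\<close>
    consider "c = 0" | "1 \<le> c" "c < b" | "1 \<le> c" "c = b" | d where "c = b + Suc d" "Suc d < m"
      | "c = b + m" | d where "c = b + m + Suc d"
      by (metis One_nat_def add_Suc_right less_imp_Suc_add linorder_neqE_nat nat_add_left_cancel_less
          not_less_eq_eq zero_less_iff_neq_zero Suc_le_eq)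
    then show ?thesis
    proof cases
      case 1
      then show ?thesis
        using m unfolding mem D\<pi> D\<sigma> by simp
    next
      case 2
      have "\<pi> ! c < \<pi> ! (c - 1) \<longleftrightarrow> \<sigma> ! c < \<sigma> ! (c - 1)"
        using 2 n \<pi>_before[of c] \<pi>_before[of "c - 1"] make_room_less_iff[OF ne[of c] ne[of "c - 1"], of m] by simp
      then show ?thesis
        using 2 m n unfolding mem D\<pi> D\<sigma> by simp
    next
      case 3
      have "\<pi> ! c < \<pi> ! (c - 1) \<longleftrightarrow> \<sigma> ! c < \<sigma> ! (c - 1)"
        using 3 n m v \<pi>_block[of 0] \<pi>_before[of "c - 1"]
          make_room_block_less_iff(2)[OF ne[of "c - 1"] \<tau>_bounds[of 0]] by simp
      then show ?thesis
        using 3 m n unfolding mem D\<pi> D\<sigma> by simp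
    next
      case 4
      have "\<pi> ! c < \<pi> ! (c - 1) \<longleftrightarrow> \<tau> ! Suc d < \<tau> ! d"
        using 4 v_pos \<pi>_block[of d] \<pi>_block[of "Suc d"] \<tau>_bounds[of d] \<tau>_bounds[of "Suc d"] by auto
      then show ?thesis
        using 4 m n unfolding mem D\<pi> D\<tau> by simp
    next
      case 5
      have "\<pi> ! c < \<pi> ! (c - 1) \<longleftrightarrow> \<sigma> ! (b + 1) < \<sigma> ! b" if "b + 1 < n"
        using 5 that m v \<pi>_block[of "m - 1"] \<pi>_after[of 0]
          make_room_block_less_iff(1)[OF ne[of "b + 1"] \<tau>_bounds[of "m - 1"]] by simp
      then show ?thesis
        using 5 m n unfolding mem D\<pi> D\<tau> D\<sigma> by auto
    next
      case 6
      have "\<pi> ! c < \<pi> ! (c - 1) \<longleftrightarrow> \<sigma> ! (b + 1 + Suc d) < \<sigma> ! (b + 1 + d)" if "b + 1 + Suc d < n"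
        using 6 that \<pi>_after[of d] \<pi>_after[of "Suc d"]
          make_room_less_iff[OF ne[of "b + 1 + Suc d"] ne[of "b + 1 + d"], of m] by simp
      then show ?thesis
        using 6 m n unfolding mem D\<pi> D\<tau> D\<sigma> by auto
    qed
  qed
  then show ?thesis
    by (auto simp: \<pi>_def b)
qed

text \<open>Both trees are lifted to permutations, where \<open>left_leaves\<close> is \<open>Des\<close>.\<close>

lemma left_leaves_tree_comp:
  assumes a: "1 \<le> i" "i \<le> n" "m \<ge> 1" and s: "s \<in> trees n" and t: "t \<in> trees m"
  shows "left_leaves (tree_comp i s t) = subset_comp n m i (left_leaves s) (left_leaves t)"
proof -
  obtain \<sigma> \<tau> where *: "\<sigma> \<in> perms n" "s = perm_tree \<sigma>" "\<tau> \<in> perms m" "t = perm_tree \<tau>"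
    using s t unfolding perm_tree_image[symmetric] by blast
  have "left_leaves (tree_comp i s t) = left_leaves (perm_tree (perm_comp i \<sigma> \<tau>))"
    unfolding * perm_tree_perm_comp[OF a *(1,3)] ..
  also have "\<dots> = Des (perm_comp i \<sigma> \<tau>)"
    by (rule left_leaves_perm_tree[OF perm_comp_closed[OF a *(1,3)]])
  also have "\<dots> = subset_comp n m i (Des \<sigma>) (Des \<tau>)"
    by (rule Des_perm_comp[OF a *(1,3)])
  also have "\<dots> = subset_comp n m i (left_leaves s) (left_leaves t)"
    unfolding * left_leaves_perm_tree[OF *(1)] left_leaves_perm_tree[OF *(3)] ..
  finally show ?thesis .
qed

lemma left_leaves_image:
  assumes "n \<ge> 1"
  shows "left_leaves ` trees n = subsets n"
proof -
  have "left_leaves ` trees n = (\<lambda>\<sigma>. left_leaves (perm_tree \<sigma>)) ` perms n"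
    by (simp add: perm_tree_image[symmetric] image_image)
  also have "\<dots> = Des ` perms n"
    by (intro image_cong refl left_leaves_perm_tree)
  finally show ?thesis using Des_image[OF assms] by simp
qed

lemma perm_tree_unit: "perm_tree [1] = Leaf \<or>\<^sub>t Leaf"
  using dec_tree_split[of "[]" 1 "[]"] dec_tree_perms[of "[1]" 1] by (simp add: perms_iff)

lemma Des_unit: "Des [1] = {}"
  by (simp add: Des_def)

lemma left_leaves_unit: "left_leaves (Leaf \<or>\<^sub>t Leaf) = {}"
  by (simp add: left_leaves_def)

lemma set_operad_trees: "set_operad trees (\<lambda>n m. tree_comp) (Leaf \<or>\<^sub>t Leaf)"
  by (rule set_operad_surjection[where \<phi> = "\<lambda>n. perm_tree", OF set_operad_perms])
    (auto simp: perm_tree_image perm_tree_perm_comp perm_tree_unit[simplified])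

lemma set_operad_subsets: "set_operad subsets subset_comp {}"
  by (rule set_operad_surjection[where \<phi> = "\<lambda>n. Des", OF set_operad_perms])
    (auto simp: Des_image Des_perm_comp Des_unit[simplified])

theorem corollary4p3:
  fixes R :: "('k, 'r) ring_scheme"
  assumes "cring R"
  shows "surjective_ns_operad_morphism R (operad_Y R) (operad_Q R) (map_L R) \<and>
         surjective_ns_operad_morphism R (operad_A R) (operad_Y R) (map_Lambda R) \<and>
         surjective_ns_operad_morphism R (operad_A R) (operad_Q R) (map_D R) \<and>
         (\<forall>n\<ge>1. \<forall>x\<in>carrier (cmp (operad_A R) n).
            map_L R n (map_Lambda R n x) = map_D R n x)"
proof (intro conjI allI impI ballI)
  show "surjective_ns_operad_morphism R (operad_Y R) (operad_Q R) (map_L R)"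
    unfolding operad_Y_def operad_Q_def map_L_def
    by (rule surjective_ns_operad_morphism_linear_ext[where \<phi> = "\<lambda>n. left_leaves",
          OF assms set_operad_trees set_operad_subsets])
      (fact left_leaves_image left_leaves_tree_comp left_leaves_unit)+
  show "surjective_ns_operad_morphism R (operad_A R) (operad_Y R) (map_Lambda R)"
    unfolding operad_A_def operad_Y_def map_Lambda_def
    by (rule surjective_ns_operad_morphism_linear_ext[where \<phi> = "\<lambda>n. perm_tree",
          OF assms set_operad_perms set_operad_trees])
      (rule perm_tree_image, (fact perm_tree_perm_comp perm_tree_unit)+)
  show "surjective_ns_operad_morphism R (operad_A R) (operad_Q R) (map_D R)"
    unfolding operad_A_def operad_Q_def map_D_def
    by (rule surjective_ns_operad_morphism_linear_ext[where \<phi> = "\<lambda>n. Des",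
          OF assms set_operad_perms set_operad_subsets])
      (fact Des_image Des_perm_comp Des_unit)+
  fix n :: nat and x assume n: "n \<ge> 1" and x: "x \<in> carrier (cmp (operad_A R) n)"
  interpret cring R by fact
  have "x \<in> carrier (free_module R (perms n))"
    using x by (simp add: operad_A_def basis_operad_def)
  then show "map_L R n (map_Lambda R n x) = map_D R n x"
    unfolding map_D_def map_L_def map_Lambda_def using n perm_tree_image left_leaves_image
    by (intro linear_ext_comp set_operad.fin[OF set_operad_perms] set_operad.fin[OF set_operad_trees] left_leaves_perm_tree)
      blast+
qed

end
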